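(* Let $\nu$ be a positive integer and, for $k=1,\dots,\nu$, let $N_k=n_k+n_{k+1}+\dots+n_\nu$. Let $C=\binom{\nu+2}{2}$. Then for $|q|<1$, \begin{align*} \sum_{\substack{i,m,n_1,\dots,n_\nu\geq 0,\\ i+m \equiv N_1+N_2+\dots + N_\nu \ (\mathrm{mod}\ 2)}} &\frac{q^{\frac{m^2+3(i^2+N_1^2+N_2^2+\dots + N_\nu^2)}{2}}}{(q^3;q^3)_i} {3n_\nu\brack m}_{q}{2n_\nu + \frac{i-N_1-N_2-\dots-N_\nu-m}{2}\brack 2n_\nu}_{q^3} \prod_{j=1}^{\nu-1} {i- \sum_{k=1}^j N_k+n_j \brack n_j}_{q^3}\\ &= \frac{(q^{6C},-q^{3C+1},-q^{3C-1};q^{6C})_\infty}{(q^{3};q^{3})_\infty}. \end{align*}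
   Context: For $n\ge 0$, $(a;q)_n=\prod_{k=0}^{n-1}(1-aq^k)$, $(a;q)_\infty=\prod_{k\ge0}(1-aq^k)$, $(a_1,\dots,a_r;q)_\infty=\prod_{s=1}^r(a_s;q)_\infty$. For integers $A,B$, ${A\brack B}_x=\frac{(x;x)_A}{(x;x)_B(x;x)_{A-B}}$ if $B\ge 0$ and $A-B\ge 0$, and $0$ otherwise. An empty product equals $1$. *)

theory Defs
  imports "HOL-Analysis.Analysis" "HOL-Number_Theory.Cong"
begin

definition qpoch :: "complex \<Rightarrow> complex \<Rightarrow> nat \<Rightarrow> complex" where
  "qpoch a q n = (\<Prod>k<n. 1 - a * q ^ k)"

text \<open>The product converges for every \<open>a\<close> when \<open>norm q < 1\<close>.\<close>

definition qpoch_inf :: "complex \<Rightarrow> complex \<Rightarrow> complex" where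
  "qpoch_inf a q = (\<Prod>k. 1 - a * q ^ k)"

definition qpoch_infs :: "complex list \<Rightarrow> complex \<Rightarrow> complex" where
  "qpoch_infs as q = (\<Prod>a\<leftarrow>as. qpoch_inf a q)"

definition qbinom :: "int \<Rightarrow> int \<Rightarrow> complex \<Rightarrow> complex" where
  "qbinom A B x =
     (if B \<ge> 0 \<and> A - B \<ge> 0
      then qpoch x x (nat A) / (qpoch x x (nat B) * qpoch x x (nat (A - B)))
      else 0)"

definition tail_sum :: "nat \<Rightarrow> (nat \<Rightarrow> nat) \<Rightarrow> nat \<Rightarrow> nat" where
  "tail_sum \<nu> n k = (\<Sum>j=k..\<nu>. n j)"

text \<open>A tuple $(n_1,\dots,n_\nu)$ is a function on \<open>{1..\<nu>}\<close>, made unique by requiring it to be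
  extensional (constantly \<open>undefined\<close> outside that set).\<close>

definition index_set :: "nat \<Rightarrow> (nat \<times> nat \<times> (nat \<Rightarrow> nat)) set" where
  "index_set \<nu> = {(i, m, n). n \<in> {1..\<nu>} \<rightarrow>\<^sub>E UNIV \<and>
     [i + m = (\<Sum>k=1..\<nu>. tail_sum \<nu> n k)] (mod 2)}"

text \<open>On \<open>index_set \<nu>\<close> both divisions by 2 below are exact; the one on \<^typ>\<open>int\<close> may have a
  negative result.\<close>

definition summand :: "nat \<Rightarrow> complex \<Rightarrow> nat \<Rightarrow> nat \<Rightarrow> (nat \<Rightarrow> nat) \<Rightarrow> complex" where
  "summand \<nu> q i m n = (let N = tail_sum \<nu> n in
     q ^ ((m\<^sup>2 + 3 * (i\<^sup>2 + (\<Sum>k=1..\<nu>. (N k)\<^sup>2))) div 2) / qpoch (q ^ 3) (q ^ 3) i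
     * qbinom (3 * int (n \<nu>)) (int m) q
     * qbinom (2 * int (n \<nu>) + (int i - (\<Sum>k=1..\<nu>. int (N k)) - int m) div 2)
              (2 * int (n \<nu>)) (q ^ 3)
     * (\<Prod>j=1..\<nu>-1. qbinom (int i - (\<Sum>k=1..j. int (N k)) + int (n j)) (int (n j)) (q ^ 3)))"

end

theory Submission
  imports Defs "HOL-Computational_Algebra.Polynomial"
begin

text \<open>Put $q = s^2$ and $Q = q^3$, so that every half-integral power of $Q$ is a power of $s$.
  Warnaar's refined $q$-trinomial coefficients $T(L,M;a,b)$ in base $Q$ satisfy
  $\sum_r Q^{r^2/2} {L+M-r \brack L} T(L-r,r;a,b) = Q^{b^2/2} T(L,M;a+b,b)$ for $a \ge b \ge 0$.
  By the $q$-Pfaff-Saalschuetz sum and the factorization of $(-zq^{1/2};q)_{3M}$ into three products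
  in base $Q$, the sum over $m$ equals $\sum_j q^{3j^2/2+j}\, T(L,M;j,j)$. The sums over
  $n_\nu, \dots, n_1$ are $\nu$ applications of the transformation, the last one with $M = \infty$,
  and turn $T(L,M;j,j)$ into $Q^{\nu j^2/2}\, T(i,\infty;(\nu+1)j,j)$. Since
  $\sum_i Q^{i^2/2}\, T(i,\infty;a,b) = Q^{a^2/2}/(Q;Q)_\infty$, what remains is the theta series
  $\sum_j q^{3Cj^2+j}$, to which the Jacobi triple product applies.\<close>

section \<open>Gaussian binomials and infinite products\<close>

text \<open>The origin of \<open>C\<close>: in powers of \<open>s\<close>, the coefficient of j^2 in
  the exponent of the j-th term is 3 from the sum over \<open>m\<close>, another 3 from each of the
  \<nu> transformations, and 3(\<nu>+1)^2 from the final sum over \<open>i\<close>; together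
  3(\<nu>+1)(\<nu>+2) = 6C. The linear part 2j comes from the sum over \<open>m\<close> alone and is
  the source of the shifts +1 and -1 in the product. The obstacle is the transformation: its
  parameters \<open>a\<close>, \<open>b\<close>, \<open>L\<close>, \<open>M\<close> are coupled, so
  it is proved by matching recurrences. For \<open>b = 0\<close> one recurrence closes on itself;
  the step from \<open>b\<close> to \<open>b + 1\<close> needs nested inductions on
  \<open>b\<close>, \<open>M\<close> and \<open>L\<close>. The parity condition is carried by
  \<open>ebinom\<close>, which vanishes at odd arguments, so intermediate sums run over all indices.
  For the same reason \<open>L\<close> is an integer: out-of-range terms vanish and ranges can be
  extended or cut freely.\<close>

lemma qpoch_0 [simp]: "qpoch a q 0 = 1"
  by (simp add: qpoch_def)

lemma qpoch_Suc: "qpoch a q (Suc n) = qpoch a q n * (1 - a * q ^ n)"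
  by (simp add: qpoch_def)

lemma norm_power_less_one:
  fixes x :: complex
  assumes "norm x < 1" "n > 0"
  shows "norm (x ^ n) < 1"
  using assms by (simp add: norm_power power_less_one_iff)

lemma qpoch_self_nonzero:
  assumes "norm x < 1"
  shows "qpoch x x n \<noteq> 0"
proof -
  have "x * x ^ k \<noteq> 1" for k
    using norm_power_less_one[OF assms, of "Suc k"] by auto
  thus ?thesis
    by (auto simp: qpoch_def)
qed

lemma qbinom_eq_0: "B < 0 \<or> A < B \<Longrightarrow> qbinom A B x = 0"
  by (auto simp: qbinom_def)

lemma qbinom_0_right: "A \<ge> 0 \<Longrightarrow> norm x < 1 \<Longrightarrow> qbinom A 0 x = 1"
  by (simp add: qbinom_def qpoch_self_nonzero)

lemma qbinom_self: "A \<ge> 0 \<Longrightarrow> norm x < 1 \<Longrightarrow> qbinom A A x = 1"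
  by (simp add: qbinom_def qpoch_self_nonzero)

lemma qbinom_sym: "qbinom A (A - B) x = qbinom A B x"
  by (auto simp: qbinom_def mult.commute)

lemma qbinom_nat:
  "k \<le> n \<Longrightarrow> qbinom (int n) (int k) x = qpoch x x n / (qpoch x x k * qpoch x x (n - k))"
  by (simp add: qbinom_def nat_diff_distrib)

text \<open>The origin is the only exception: there the left side is 1 and both binomials on the
  right are 0. Elsewhere the convention that out-of-range binomials vanish keeps the rule valid,
  also where \<open>nat (A - B)\<close> truncates.\<close>

lemma qbinom_pascal:
  assumes x: "norm x < 1" and AB: "A \<noteq> 0 \<or> B \<noteq> 0"
  shows "qbinom A B x = qbinom (A - 1) B x + x ^ nat (A - B) * qbinom (A - 1) (B - 1) x"
proof -
  consider "B < 0 \<or> A < B" | "B = 0" "A > 0" | "A = B" "A > 0" | "0 < B" "B < A"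
    using AB by linarith
  thus ?thesis
  proof cases
    case 4
    define k where "k = nat B - 1"
    define d where "d = nat (A - B) - 1"
    have B: "B = int (Suc k)" and A: "A = int (Suc (Suc (k + d)))"
      using 4 by (auto simp: k_def d_def)
    have 1: "qbinom A B x = qpoch x x (Suc (Suc (k + d))) / (qpoch x x (Suc k) * qpoch x x (Suc d))"
      unfolding A B by (subst qbinom_nat) (auto simp del: of_nat_Suc)
    have 2: "qbinom (A - 1) B x = qpoch x x (Suc (k + d)) / (qpoch x x (Suc k) * qpoch x x d)"
      using qbinom_nat[of "Suc k" "Suc (k + d)" x] by (simp add: A B)
    have 3: "qbinom (A - 1) (B - 1) x = qpoch x x (Suc (k + d)) / (qpoch x x k * qpoch x x (Suc d))"
      using qbinom_nat[of k "Suc (k + d)" x] by (simp add: A B Suc_diff_le)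
    have nz: "qpoch x x k \<noteq> 0" "qpoch x x d \<noteq> 0" "1 - x * x ^ k \<noteq> 0" "1 - x * x ^ d \<noteq> 0"
      using qpoch_self_nonzero[OF x, of k] qpoch_self_nonzero[OF x, of d]
        qpoch_self_nonzero[OF x, of "Suc k"] qpoch_self_nonzero[OF x, of "Suc d"]
      by (auto simp: qpoch_Suc)
    have e: "nat (A - B) = Suc d"
      by (simp add: A B)
    show ?thesis
      unfolding 1 2 3 e using nz
      by (simp add: qpoch_Suc divide_simps power_add) (simp add: algebra_simps)
  qed (auto simp: qbinom_eq_0 qbinom_0_right qbinom_self x)
qed

lemma qbinom_pascal':
  assumes x: "norm x < 1" and AB: "A \<noteq> 0 \<or> B \<noteq> 0"
  shows "qbinom A B x = x ^ nat B * qbinom (A - 1) B x + qbinom (A - 1) (B - 1) x"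
proof -
  have "qbinom A B x = qbinom (A - 1) (A - B) x + x ^ nat B * qbinom (A - 1) (A - B - 1) x"
    using qbinom_pascal[OF x, of A "A - B"] AB by (simp add: qbinom_sym)
  thus ?thesis
    using qbinom_sym[of "A - 1" B x] qbinom_sym[of "A - 1" "B - 1" x] by (simp add: algebra_simps)
qed

section \<open>Infinite products, limits and uniform bounds\<close>

lemma qpoch_tendsto:
  assumes x: "norm x < 1"
  shows "(\<lambda>n. qpoch a x n) \<longlonglongrightarrow> qpoch_inf a x"
    and "(\<And>k. a * x ^ k \<noteq> 1) \<Longrightarrow> qpoch_inf a x \<noteq> 0"
proof -
  have s: "summable (\<lambda>k. norm (1 - a * x ^ k - 1))"
    using x by (auto simp: norm_mult norm_power intro!: summable_mult summable_geometric)
  hence c: "convergent_prod (\<lambda>k. 1 - a * x ^ k)"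
    by (intro abs_convergent_prod_imp_convergent_prod) (simp add: abs_convergent_prod_conv_summable)
  have "(\<lambda>n. \<Prod>k\<le>n. 1 - a * x ^ k) \<longlonglongrightarrow> qpoch_inf a x"
    unfolding qpoch_inf_def by (rule convergent_prod_LIMSEQ[OF c])
  hence "(\<lambda>n. qpoch a x (Suc n)) \<longlonglongrightarrow> qpoch_inf a x"
    by (simp add: qpoch_def lessThan_Suc_atMost)
  thus "(\<lambda>n. qpoch a x n) \<longlonglongrightarrow> qpoch_inf a x"
    by (rule LIMSEQ_imp_Suc)
  show "qpoch_inf a x \<noteq> 0" if "\<And>k. a * x ^ k \<noteq> 1"
    unfolding qpoch_inf_def using c that by (intro prodinf_nonzero) auto
qed

lemma qpoch_self_tendsto:
  assumes x: "norm x < 1"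
  shows "(\<lambda>n. qpoch x x n) \<longlonglongrightarrow> qpoch_inf x x" "qpoch_inf x x \<noteq> 0"
proof -
  have "x * x ^ k \<noteq> 1" for k
    using norm_power_less_one[OF x, of "Suc k"] by auto
  thus "(\<lambda>n. qpoch x x n) \<longlonglongrightarrow> qpoch_inf x x" "qpoch_inf x x \<noteq> 0"
    using qpoch_tendsto[OF x, of x] by auto
qed

lemma inverse_qpoch_bounded:
  assumes x: "norm x < 1"
  obtains K where "K \<ge> 1" "\<And>n. norm (1 / qpoch x x n) \<le> K"
proof -
  have "(\<lambda>n. 1 / qpoch x x n) \<longlonglongrightarrow> 1 / qpoch_inf x x"
    by (intro tendsto_intros qpoch_self_tendsto x)
  hence "Bseq (\<lambda>n. 1 / qpoch x x n)"
    by (intro convergent_imp_Bseq) (auto simp: convergent_def)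
  then obtain K where "\<And>n. norm (1 / qpoch x x n) \<le> K"
    by (auto elim!: BseqE)
  thus ?thesis
    by (intro that[of "max K 1"]) (auto simp: max.coboundedI1)
qed

text \<open>Both (x;x)_n and its reciprocal converge, hence are bounded, and this gives one bound
  for all \<open>A\<close> and \<open>B\<close>. It supplies dominating constants for the limits and
  for the multisum.\<close>

lemma qbinom_bounded:
  assumes x: "norm x < 1"
  obtains K where "K \<ge> 1" "\<And>A B. norm (qbinom A B x) \<le> K"
proof -
  have "Bseq (\<lambda>n. qpoch x x n)"
    using qpoch_self_tendsto(1)[OF x] by (intro convergent_imp_Bseq) (auto simp: convergent_def)
  then obtain K1 where K1: "\<And>n. norm (qpoch x x n) \<le> K1"
    by (auto elim!: BseqE)
  obtain K2 where K2: "K2 \<ge> 1" "\<And>n. norm (1 / qpoch x x n) \<le> K2"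
    using inverse_qpoch_bounded[OF x] by blast
  have nn: "K1 \<ge> 0"
    using K1[of 0] by simp
  have "norm (qbinom A B x) \<le> K1 * (K2 * K2)" for A B
  proof (cases "B \<ge> 0 \<and> A - B \<ge> 0")
    case True
    have "norm (qbinom A B x) = norm (qpoch x x (nat A))
        * (norm (1 / qpoch x x (nat B)) * norm (1 / qpoch x x (nat (A - B))))"
      using True by (simp add: qbinom_def norm_mult norm_divide)
    also have "\<dots> \<le> K1 * (K2 * K2)"
      by (intro mult_mono K1 K2) (use K2 nn in auto)
    finally show ?thesis .
  qed (use nn K2 in \<open>auto simp: qbinom_def\<close>)
  thus ?thesis
    by (intro that[of "max (K1 * (K2 * K2)) 1"]) (auto simp: max.coboundedI1)
qed

lemma qbinom_tendsto:
  assumes x: "norm x < 1"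
  shows "(\<lambda>n. qbinom (int n + c) (int k) x) \<longlonglongrightarrow> 1 / qpoch x x k"
proof -
  \<comment> \<open>Shifting \<open>n\<close> by \<open>k + nat \<bar>c\<bar>\<close> turns the
    upper index into \<open>n + k + d\<close>, a natural number not below \<open>k\<close>, so
    \<open>qbinom_nat\<close> applies.\<close>
  define d where "d = nat (\<bar>c\<bar> + c)"
  have "(\<lambda>n. qpoch x x (n + k + d) / (qpoch x x k * qpoch x x (n + d)))
      \<longlonglongrightarrow> qpoch_inf x x / (qpoch x x k * qpoch_inf x x)"
    unfolding add.assoc
    by (intro tendsto_intros LIMSEQ_ignore_initial_segment qpoch_self_tendsto x)
      (simp_all add: x qpoch_self_nonzero qpoch_self_tendsto)
  also have "(\<lambda>n. qpoch x x (n + k + d) / (qpoch x x k * qpoch x x (n + d)))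
      = (\<lambda>n. qbinom (int (n + k + d)) (int k) x)"
    by (rule ext, subst qbinom_nat) auto
  also have "\<dots> = (\<lambda>n. qbinom (int (n + (k + nat \<bar>c\<bar>)) + c) (int k) x)"
    by (rule ext, rule arg_cong[where f = "\<lambda>z. qbinom z (int k) x"]) (auto simp: d_def)
  finally have "(\<lambda>n. qbinom (int (n + (k + nat \<bar>c\<bar>)) + c) (int k) x) \<longlonglongrightarrow> 1 / qpoch x x k"
    using qpoch_self_tendsto[OF x] by simp
  thus ?thesis
    by (rule LIMSEQ_offset)
qed

text \<open>Appending the factor \<open>[:1, u * x ^ n:]\<close> is Pascal's rule for the
  coefficients. The polynomial form of the q-binomial theorem allows the coefficients of two
  factorizations of one product to be compared, as \<open>cubic_sum_eq_triple\<close> does.\<close>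

lemma coeff_qbinom_theorem:
  assumes x: "norm x < 1"
  shows "coeff (\<Prod>i<n. [:1, u * x ^ i:]) m = u ^ m * x ^ (m * (m - 1) div 2) * qbinom (int n) (int m) x"
proof (induction n arbitrary: m)
  case 0
  show ?case
    by (cases m) (auto simp: qbinom_0_right x qbinom_eq_0)
next
  case (Suc n)
  show ?case
  proof (cases m)
    case 0
    have "coeff (\<Prod>i<Suc n. [:1, u * x ^ i:]) 0 = coeff (\<Prod>i<n. [:1, u * x ^ i:]) 0"
      by (simp add: mult.commute)
    thus ?thesis
      using 0 Suc.IH[of 0] by (simp add: qbinom_0_right x)
  next
    case (Suc k)
    have "coeff (\<Prod>i<Suc n. [:1, u * x ^ i:]) (Suc k)
        = coeff (\<Prod>i<n. [:1, u * x ^ i:]) (Suc k) + u * x ^ n * coeff (\<Prod>i<n. [:1, u * x ^ i:]) k"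
      by (simp add: mult.commute)
    also have "\<dots> = u ^ Suc k * (x ^ (Suc k * k div 2) * qbinom (int n) (int (Suc k)) x
        + x ^ (n + k * (k - 1) div 2) * qbinom (int n) (int k) x)"
      by (simp add: Suc.IH power_add algebra_simps)
    \<comment> \<open>The two exponents agree for \<open>k \<le> n\<close>; beyond that the binomial
      is zero.\<close>
    also have "x ^ (n + k * (k - 1) div 2) * qbinom (int n) (int k) x
        = x ^ (Suc k * k div 2 + nat (int (Suc n) - int (Suc k))) * qbinom (int n) (int k) x"
    proof (cases "k \<le> n")
      case True
      have "Suc k * k = k * (k - 1) + 2 * k"
        by (cases k) auto
      hence "Suc k * k div 2 = k * (k - 1) div 2 + k"
        by simp
      with True show ?thesis
        by (auto simp: nat_diff_distrib add.commute)
    qed (simp add: qbinom_eq_0)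
    also have "u ^ Suc k * (x ^ (Suc k * k div 2) * qbinom (int n) (int (Suc k)) x + \<dots>)
        = u ^ Suc k * x ^ (Suc k * k div 2) * qbinom (int (Suc n)) (int (Suc k)) x"
      by (subst (3) qbinom_pascal[OF x]) (auto simp: power_add algebra_simps)
    finally show ?thesis
      by (simp add: Suc)
  qed
qed

text \<open>A weight that depends only on the total degree splits along the factors of a product.
  Applied twice, this separates the sum over \<open>m\<close> into the three factors of
  \<open>cubic_prod\<close>.\<close>

lemma sum_coeff_mult:
  fixes p r :: "complex poly" and \<phi> :: "nat \<Rightarrow> complex"
  assumes p: "degree p \<le> A" and r: "degree r \<le> B"
  shows "(\<Sum>m\<le>A + B. coeff (p * r) m * \<phi> m) = (\<Sum>t\<le>A. \<Sum>u\<le>B. coeff p t * coeff r u * \<phi> (t + u))"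
proof -
  have "(\<Sum>m\<le>A + B. coeff (p * r) m * \<phi> m)
      = (\<Sum>m\<le>A + B. \<Sum>i\<le>m. coeff p i * coeff r (m - i) * \<phi> (i + (m - i)))"
    by (simp add: coeff_mult sum_distrib_right)
  also have "\<dots> = (\<Sum>(i, j)\<in>{(i, j). i + j \<le> A + B}. coeff p i * coeff r j * \<phi> (i + j))"
    by (rule sum.triangle_reindex_eq[symmetric])
  also have "\<dots> = (\<Sum>(i, j)\<in>{..A} \<times> {..B}. coeff p i * coeff r j * \<phi> (i + j))"
  proof (rule sum.mono_neutral_right)
    show "finite {(i, j). i + j \<le> A + B}"
      by (rule finite_subset[of _ "{..A + B} \<times> {..A + B}"]) auto
    show "\<forall>x\<in>{(i, j). i + j \<le> A + B} - {..A} \<times> {..B}.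
        (case x of (i, j) \<Rightarrow> coeff p i * coeff r j * \<phi> (i + j)) = 0"
      using p r by (auto simp: not_le intro!: coeff_eq_0)
  qed auto
  also have "\<dots> = (\<Sum>t\<le>A. \<Sum>u\<le>B. coeff p t * coeff r u * \<phi> (t + u))"
    by (simp add: sum.cartesian_product)
  finally show ?thesis .
qed

lemma triangle_exp: "2 * (m * (m - 1) div 2) + m = (m::nat)\<^sup>2"
  by (cases m) (auto simp: power2_eq_square)

section \<open>Absolutely convergent sums over products, and dominated convergence\<close>

lemma abs_summable_on_times:
  fixes f :: "'a \<Rightarrow> complex" and h :: "'b \<Rightarrow> complex"
  assumes f: "(\<lambda>x. norm (f x)) summable_on A" and h: "(\<lambda>y. norm (h y)) summable_on B"
  shows "(\<lambda>(x, y). norm (f x * h y)) summable_on A \<times> B"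
proof (rule summable_on_SigmaI)
  show "((\<lambda>y. case (x, y) of (x, y) \<Rightarrow> norm (f x * h y)) has_sum norm (f x) * (\<Sum>\<^sub>\<infinity>y\<in>B. norm (h y))) B" for x
    using has_sum_cmult_right[OF has_sum_infsum[OF h], of "norm (f x)"] by (simp add: norm_mult)
  show "(\<lambda>x. norm (f x) * (\<Sum>\<^sub>\<infinity>y\<in>B. norm (h y))) summable_on A"
    by (rule summable_on_cmult_left[OF f])
qed auto

lemma has_sum_times:
  fixes f :: "'a \<Rightarrow> complex" and h :: "'b \<Rightarrow> complex"
  assumes f: "(f has_sum a) A" "(\<lambda>x. norm (f x)) summable_on A"
    and h: "(h has_sum b) B" "(\<lambda>y. norm (h y)) summable_on B"
  shows "((\<lambda>(x, y). f x * h y) has_sum a * b) (A \<times> B)"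
proof (rule has_sum_SigmaI)
  show "((\<lambda>y. case (x, y) of (x, y) \<Rightarrow> f x * h y) has_sum f x * b) B" for x
    using has_sum_cmult_right[OF h(1), of "f x"] by simp
  show "((\<lambda>x. f x * b) has_sum a * b) A"
    by (rule has_sum_cmult_left[OF f(1)])
  show "(\<lambda>(x, y). f x * h y) summable_on A \<times> B"
    by (rule abs_summable_summable)
      (use abs_summable_on_times[OF f(2) h(2)] in \<open>simp add: case_prod_unfold\<close>)
qed

lemma geometric_summable_on:
  fixes x :: complex
  assumes "norm x < 1"
  shows "(\<lambda>n. norm (x ^ n)) summable_on (UNIV :: nat set)"
  using assms by (subst summable_on_UNIV_nonneg_real_iff) (auto simp: norm_power intro!: summable_geometric)

lemma geometric_int_summable_on:
  fixes x :: complex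
  assumes x: "norm x < 1"
  shows "(\<lambda>j. norm (x ^ nat \<bar>j\<bar>)) summable_on (UNIV :: int set)"
proof -
  have "(\<lambda>j. norm (x ^ nat \<bar>j\<bar>)) summable_on range int"
    using geometric_summable_on[OF x] by (subst summable_on_reindex) (auto simp: o_def)
  moreover have "(\<lambda>j. norm (x ^ nat \<bar>j\<bar>)) summable_on (\<lambda>n. - int n) ` {0<..}"
    using summable_on_subset_banach[OF geometric_summable_on[OF x], of "{0<..}"]
    by (subst summable_on_reindex) (auto simp: o_def inj_on_def)
  ultimately have "(\<lambda>j. norm (x ^ nat \<bar>j\<bar>)) summable_on range int \<union> (\<lambda>n. - int n) ` {0<..}"
    by (rule summable_on_Un_disjoint) auto
  also have "range int \<union> (\<lambda>n. - int n) ` {0<..} = UNIV"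
  proof -
    have "j \<in> range int \<union> (\<lambda>n. - int n) ` {0<..}" for j
    proof (cases "j \<ge> 0")
      case True
      hence "j = int (nat j)" by simp
      thus ?thesis by blast
    next
      case False
      hence "j = - int (nat (- j))" "nat (- j) \<in> {0<..}" by auto
      thus ?thesis by blast
    qed
    thus ?thesis by blast
  qed
  finally show ?thesis .
qed

text \<open>Carries an identity between finite sums to the limit. By \<open>fin\<close> each finite
  sum is a full series, which is the form that Tannery's theorem takes.\<close>

lemma tannery_has_sum:
  fixes a :: "nat \<Rightarrow> nat \<Rightarrow> complex"
  assumes lim: "\<And>k. (\<lambda>n. a k n) \<longlonglongrightarrow> b k" and bound: "\<And>k n. norm (a k n) \<le> M k"
    and M: "summable M" and fin: "\<And>n k. k > n \<Longrightarrow> a k n = 0"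
    and S: "(\<lambda>n. \<Sum>k\<le>n. a k n) \<longlonglongrightarrow> S"
  shows "(b has_sum S) UNIV" and "(\<lambda>k. norm (b k)) summable_on UNIV"
proof -
  have "eventually (\<lambda>(k, n). norm (a k n) \<le> M k) (at_top \<times>\<^sub>F sequentially)"
    using bound by (intro always_eventually) auto
  note * = tannerys_theorem[OF lim this M, simplified]
  have "suminf (\<lambda>k. a k n) = (\<Sum>k\<le>n. a k n)" for n
    by (rule suminf_finite) (auto simp: fin)
  hence "suminf b = S"
    using * S LIMSEQ_unique by auto
  moreover have sm: "summable (\<lambda>n. norm (b n))"
    using * by blast
  ultimately have "b sums S"
    using summable_norm_cancel summable_sums by blast
  thus "(b has_sum S) UNIV"
    by (rule norm_summable_imp_has_sum[OF sm])
  show "(\<lambda>k. norm (b k)) summable_on UNIV"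
    using sm by (subst summable_on_UNIV_nonneg_real_iff) auto
qed

section \<open>The series of Euler and Cauchy, and the Jacobi triple product\<close>

lemma qbinom_tendsto_nat:
  assumes "norm x < 1"
  shows "(\<lambda>n. qbinom (int n) (int k) x) \<longlonglongrightarrow> 1 / qpoch x x k"
  using qbinom_tendsto[OF assms, of 0 k] by simp

lemma norm_power_le_power:
  fixes x :: complex
  assumes "norm x \<le> 1" "m \<le> n"
  shows "norm (x ^ n) \<le> norm (x ^ m)"
  using assms by (simp add: norm_power power_decreasing)

text \<open>Limit of the finite q-binomial theorem at z = 1, where the polynomial becomes a partial
  product. The bound on \<open>u\<close> provides the dominating geometric series.\<close>

lemma euler_has_sum:
  fixes u x :: complex
  assumes x: "norm x < 1" and u: "norm u < 1"
  shows "((\<lambda>k. u ^ k * x ^ (k * (k - 1) div 2) / qpoch x x k) has_sum qpoch_inf (- u) x) UNIV"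
    and "(\<lambda>k. norm (u ^ k * x ^ (k * (k - 1) div 2) / qpoch x x k)) summable_on UNIV"
proof -
  obtain K where K: "K \<ge> 1" "\<And>A B. norm (qbinom A B x) \<le> K"
    using qbinom_bounded[OF x] by blast
  define a where "a k n = u ^ k * x ^ (k * (k - 1) div 2) * qbinom (int n) (int k) x" for k n
  have lim: "(\<lambda>n. a k n) \<longlonglongrightarrow> u ^ k * x ^ (k * (k - 1) div 2) / qpoch x x k" for k
    using tendsto_mult_left[OF qbinom_tendsto_nat[OF x, of k], of "u ^ k * x ^ (k * (k - 1) div 2)"]
    by (simp add: a_def)
  have bound: "norm (a k n) \<le> norm (u ^ k) * K" for k n
  proof -
    have "norm (a k n) = norm (u ^ k) * norm (x ^ (k * (k - 1) div 2)) * norm (qbinom (int n) (int k) x)"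
      by (simp add: a_def norm_mult)
    also have "\<dots> \<le> norm (u ^ k) * 1 * K"
      using x by (intro mult_mono K) (auto simp: norm_power power_le_one)
    finally show ?thesis by simp
  qed
  have M: "summable (\<lambda>k. norm (u ^ k) * K)"
    using u by (auto simp: norm_power intro!: summable_mult2 summable_geometric)
  have fin: "a k n = 0" if "k > n" for k n
    using that by (simp add: a_def qbinom_eq_0)
  have "(\<Sum>k\<le>n. a k n) = qpoch (- u) x n" for n
  proof -
    define p where "p = (\<Prod>i<n. [:1, u * x ^ i:])"
    have c: "coeff p k = a k n" for k
      unfolding p_def a_def by (rule coeff_qbinom_theorem[OF x])
    have "degree p \<le> n"
      by (rule degree_le) (simp add: c fin)
    hence "(\<Sum>k\<le>n. a k n) = (\<Sum>k\<le>degree p. coeff p k)"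
      unfolding c[symmetric] by (intro sum.mono_neutral_right) (auto simp: coeff_eq_0)
    also have "\<dots> = poly p 1"
      by (simp add: poly_altdef)
    also have "\<dots> = qpoch (- u) x n"
      by (simp add: p_def poly_prod qpoch_def)
    finally show ?thesis .
  qed
  hence S: "(\<lambda>n. \<Sum>k\<le>n. a k n) \<longlonglongrightarrow> qpoch_inf (- u) x"
    using qpoch_tendsto(1)[OF x, of "- u"] by simp
  show "((\<lambda>k. u ^ k * x ^ (k * (k - 1) div 2) / qpoch x x k) has_sum qpoch_inf (- u) x) UNIV"
    "(\<lambda>k. norm (u ^ k * x ^ (k * (k - 1) div 2) / qpoch x x k)) summable_on UNIV"
    using tannery_has_sum[OF lim bound M fin S] by blast+
qed

text \<open>Pascal's rule splits the sum; after a shift of \<open>r\<close> the second half is the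
  same sum with \<open>a + 1\<close>, hence an induction for all \<open>a\<close> at once. This form
  of q-Vandermonde serves twice: its limit is Cauchy's identity, and it is the inner sum in
  \<open>trinom_lim_has_sum_nat\<close>.\<close>

lemma qvandermonde_sum:
  assumes x: "norm x < 1"
  shows "(\<Sum>r\<le>n. x ^ (r * (r + a)) * qbinom (int n) (int r) x / qpoch x x (r + a)) = 1 / qpoch x x (n + a)"
proof (induction n arbitrary: a)
  case 0
  show ?case by (simp add: qbinom_0_right x)
next
  case (Suc n)
  define w where "w r = x ^ (r * (r + a)) / qpoch x x (r + a)" for r
  have p: "qbinom (int (Suc n)) (int r) x
      = qbinom (int n) (int r) x + x ^ (Suc n - r) * qbinom (int n) (int r - 1) x" for r
  proof -
    have "nat (int (Suc n) - int r) = Suc n - r" by linarith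
    thus ?thesis
      using qbinom_pascal[OF x, of "int (Suc n)" "int r"] by simp
  qed
  have "(\<Sum>r\<le>Suc n. x ^ (r * (r + a)) * qbinom (int (Suc n)) (int r) x / qpoch x x (r + a))
      = (\<Sum>r\<le>Suc n. w r * qbinom (int n) (int r) x)
      + (\<Sum>r\<le>Suc n. w r * x ^ (Suc n - r) * qbinom (int n) (int r - 1) x)"
    unfolding p sum.distrib[symmetric]
    by (intro sum.cong refl) (simp add: w_def algebra_simps add_divide_distrib)
  also have "(\<Sum>r\<le>Suc n. w r * qbinom (int n) (int r) x) = 1 / qpoch x x (n + a)"
    using Suc[of a] by (simp add: w_def qbinom_eq_0 mult_ac)
  also have "(\<Sum>r\<le>Suc n. w r * x ^ (Suc n - r) * qbinom (int n) (int r - 1) x)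
      = (\<Sum>r\<le>n. w (Suc r) * x ^ (n - r) * qbinom (int n) (int r) x)"
    by (subst sum.atMost_Suc_shift) (simp add: qbinom_eq_0)
  also have "\<dots> = x ^ (Suc n + a) * (\<Sum>r\<le>n. x ^ (r * (r + Suc a)) * qbinom (int n) (int r) x / qpoch x x (r + Suc a))"
    unfolding sum_distrib_left
  proof (intro sum.cong refl)
    fix r assume "r \<in> {..n}"
    hence "Suc r * (Suc r + a) + (n - r) = Suc n + a + r * (r + Suc a)"
      by (simp add: algebra_simps)
    hence e: "x ^ (Suc r * (Suc r + a)) * x ^ (n - r) = x ^ (Suc n + a) * x ^ (r * (r + Suc a))"
      by (simp only: power_add[symmetric])
    have "w (Suc r) * x ^ (n - r) * qbinom (int n) (int r) x
       = x ^ (Suc r * (Suc r + a)) * x ^ (n - r) * qbinom (int n) (int r) x / qpoch x x (r + Suc a)"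
      by (simp add: w_def del: power_Suc mult_Suc)
    thus "w (Suc r) * x ^ (n - r) * qbinom (int n) (int r) x
       = x ^ (Suc n + a) * (x ^ (r * (r + Suc a)) * qbinom (int n) (int r) x / qpoch x x (r + Suc a))"
      unfolding e by (simp only: mult.assoc times_divide_eq_right)
  qed
  also have "\<dots> = x ^ (Suc n + a) / qpoch x x (Suc n + a)"
    using Suc[of "Suc a"] by simp
  also have "1 / qpoch x x (n + a) + x ^ (Suc n + a) / qpoch x x (Suc n + a) = 1 / qpoch x x (Suc n + a)"
    using qpoch_self_nonzero[OF x, of "n + a"] qpoch_self_nonzero[OF x, of "Suc (n + a)"]
    by (auto simp: qpoch_Suc divide_simps)
  finally show ?case .
qed

text \<open>The Durfee rectangle identity, as the limit of q-Vandermonde.\<close>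

lemma cauchy_has_sum:
  fixes x :: complex
  assumes x: "norm x < 1"
  shows "((\<lambda>r. x ^ (r * (r + a)) / (qpoch x x r * qpoch x x (r + a))) has_sum 1 / qpoch_inf x x) UNIV"
proof -
  obtain K where K: "K \<ge> 1" "\<And>A B. norm (qbinom A B x) \<le> K"
    using qbinom_bounded[OF x] by blast
  obtain K' where K': "K' \<ge> 1" "\<And>n. norm (1 / qpoch x x n) \<le> K'"
    using inverse_qpoch_bounded[OF x] by blast
  define c where "c r n = x ^ (r * (r + a)) * qbinom (int n) (int r) x / qpoch x x (r + a)" for r n
  have lim: "(\<lambda>n. c r n) \<longlonglongrightarrow> x ^ (r * (r + a)) / (qpoch x x r * qpoch x x (r + a))" for r
    using tendsto_mult_left[OF qbinom_tendsto_nat[OF x, of r], of "x ^ (r * (r + a)) / qpoch x x (r + a)"]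
    by (simp add: c_def mult_ac)
  have bound: "norm (c r n) \<le> norm (x ^ r) * (K * K')" for r n
  proof -
    have "r \<le> r * (r + a)"
      by (cases r) auto
    hence 1: "norm (x ^ (r * (r + a))) \<le> norm (x ^ r)"
      using x by (intro norm_power_le_power) auto
    have "norm (c r n) = norm (x ^ (r * (r + a))) * (norm (qbinom (int n) (int r) x) * norm (1 / qpoch x x (r + a)))"
      by (simp add: c_def norm_mult norm_divide)
    also have "\<dots> \<le> norm (x ^ r) * (K * K')"
      using K(1) K'(1) by (intro mult_mono K K' 1) auto
    finally show ?thesis .
  qed
  have M: "summable (\<lambda>r. norm (x ^ r) * (K * K'))"
    using x by (auto simp: norm_power intro!: summable_mult2 summable_geometric)
  have fin: "c r n = 0" if "r > n" for r n
    using that by (simp add: c_def qbinom_eq_0)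
  have S: "(\<lambda>n. \<Sum>r\<le>n. c r n) \<longlonglongrightarrow> 1 / qpoch_inf x x"
    unfolding c_def qvandermonde_sum[OF x]
    by (intro tendsto_intros LIMSEQ_ignore_initial_segment qpoch_self_tendsto x)
  show ?thesis
    by (rule tannery_has_sum(1)[OF lim bound M fin S])
qed

text \<open>Separates the product of two Euler terms whose indices differ by \<open>j\<close>: the
  theta term does not depend on \<open>l\<close>, and what remains is the weight of Cauchy's
  identity.\<close>

lemma theta_factor:
  fixes u v :: complex and l j :: nat
  defines "P \<equiv> u * v"
  shows "u ^ (l + j) * P ^ ((l + j) * (l + j - 1) div 2) * (v ^ l * P ^ (l * (l - 1) div 2))
    = u ^ (Suc j * j div 2) * v ^ (j * (j - 1) div 2) * P ^ (l * (l + j))"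
proof -
  define t where "t k = k * (k - 1) div 2" for k :: nat
  have t: "2 * t k + k = k * k" for k
    using triangle_exp[of k] by (simp add: t_def power2_eq_square)
  have tS: "Suc j * j div 2 = t j + j"
    using t[of "Suc j"] t[of j] by (simp add: t_def)
  have tl: "t (l + j) = t l + t j + l * j"
    using t[of "l + j"] t[of l] t[of j] by (simp add: algebra_simps)
  have e: "l + j + t (l + j) + t l = (t j + j) + l * (l + j)" "l + t (l + j) + t l = t j + l * (l + j)"
    unfolding tl using t[of l] by (simp_all add: algebra_simps)
  have "u ^ (l + j) * P ^ t (l + j) * (v ^ l * P ^ t l)
      = u ^ (l + j + t (l + j) + t l) * v ^ (l + t (l + j) + t l)"
    by (simp add: P_def power_mult_distrib power_add)
  also have "\<dots> = u ^ (t j + j) * v ^ t j * P ^ (l * (l + j))"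
    unfolding e by (simp add: P_def power_mult_distrib power_add)
  finally show ?thesis
    unfolding tS unfolding t_def .
qed

text \<open>Ramanujan's form of the Jacobi triple product.\<close>

lemma jacobi_triple_product:
  fixes u v :: complex
  assumes u: "norm u < 1" and v: "norm v < 1"
  shows "((\<lambda>j::int. u ^ nat (j * (j + 1) div 2) * v ^ nat (j * (j - 1) div 2))
    has_sum qpoch_inf (u * v) (u * v) * qpoch_inf (- u) (u * v) * qpoch_inf (- v) (u * v)) UNIV"
proof -
  define P where "P = u * v"
  have "norm u * norm v \<le> 1 * norm v"
    using u by (intro mult_right_mono) auto
  hence P: "norm P < 1"
    using v by (simp add: P_def norm_mult)
  define e where "e w k = w ^ k * P ^ (k * (k - 1) div 2) / qpoch P P k" for w and k :: nat
  define f where "f j = u ^ nat (j * (j + 1) div 2) * v ^ nat (j * (j - 1) div 2)" for j :: int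
  define d where "d j r = P ^ (r * (r + nat \<bar>j\<bar>)) / (qpoch P P r * qpoch P P (r + nat \<bar>j\<bar>))" for j :: int and r :: nat
  have prod: "((\<lambda>(k, l). e u k * e v l) has_sum qpoch_inf (- u) P * qpoch_inf (- v) P) (UNIV \<times> UNIV)"
    unfolding e_def by (intro has_sum_times euler_has_sum u v P)
  have f: "f (int j) = u ^ (Suc j * j div 2) * v ^ (j * (j - 1) div 2)"
      "f (- int j) = u ^ (j * (j - 1) div 2) * v ^ (Suc j * j div 2)" for j
  proof -
    have 1: "nat (int j * (int j + 1) div 2) = Suc j * j div 2"
    proof -
      have "int j * (int j + 1) div 2 = int (Suc j * j div 2)"
        unfolding zdiv_int by (simp add: algebra_simps)
      thus ?thesis by simp
    qed
    have 2: "nat (int j * (int j - 1) div 2) = j * (j - 1) div 2"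
    proof -
      have "int j * (int j - 1) div 2 = int (j * (j - 1) div 2)"
        unfolding zdiv_int by (cases j) (simp_all add: algebra_simps)
      thus ?thesis by simp
    qed
    show "f (int j) = u ^ (Suc j * j div 2) * v ^ (j * (j - 1) div 2)"
      unfolding f_def 1 2 ..
    have 3: "- int j * (- int j + 1) = int j * (int j - 1)" "- int j * (- int j - 1) = int j * (int j + 1)"
      by (simp_all add: algebra_simps)
    show "f (- int j) = u ^ (j * (j - 1) div 2) * v ^ (Suc j * j div 2)"
      unfolding f_def 3 1 2 ..
  qed
  \<comment> \<open>The two Euler series are grouped by \<open>j = k - l\<close>, with
    \<open>r = min k l\<close> along each diagonal. For negative \<open>j\<close> the roles of
    \<open>u\<close> and \<open>v\<close> are exchanged.\<close>
  have fac: "e u k * e v l = f (int k - int l) * d (int k - int l) (min k l)" for k l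
  proof (cases "l \<le> k")
    case True
    then obtain j where k: "k = l + j"
      using le_Suc_ex by blast
    have "e u k * e v l = u ^ (l + j) * P ^ ((l + j) * (l + j - 1) div 2) * (v ^ l * P ^ (l * (l - 1) div 2))
        / (qpoch P P l * qpoch P P (l + j))"
      by (simp add: e_def k)
    also have "\<dots> = f (int j) * d (int j) l"
      unfolding P_def theta_factor f by (simp add: d_def P_def)
    finally show ?thesis
      by (simp add: k)
  next
    case False
    then obtain j where l: "l = k + j"
      using le_Suc_ex nat_le_linear by blast
    have "e u k * e v l = v ^ (k + j) * (v * u) ^ ((k + j) * (k + j - 1) div 2) * (u ^ k * (v * u) ^ (k * (k - 1) div 2))
        / (qpoch P P k * qpoch P P (k + j))"
      by (simp add: e_def l P_def mult_ac)
    also have "\<dots> = f (- int j) * d (- int j) k"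
      unfolding theta_factor f by (simp add: d_def P_def mult_ac)
    finally show ?thesis
      by (simp add: l)
  qed
  have "((\<lambda>(k, l). e u k * e v l) has_sum qpoch_inf (- u) P * qpoch_inf (- v) P) (UNIV \<times> UNIV)
      = ((\<lambda>(j, r). f j * d j r) has_sum qpoch_inf (- u) P * qpoch_inf (- v) P) (UNIV \<times> UNIV)"
    by (rule has_sum_reindex_bij_witness[of _ "\<lambda>(j, r). (r + nat j, r + nat (- j))"
          "\<lambda>(k, l). (int k - int l, min k l)"])
      (auto simp: fac split: prod.splits)
  hence "((\<lambda>(j, r). f j * d j r) has_sum qpoch_inf (- u) P * qpoch_inf (- v) P) (UNIV \<times> UNIV)"
    using prod by blast
  \<comment> \<open>On every diagonal the sum over \<open>r\<close> is Cauchy's identity, whose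
    value does not depend on \<open>j\<close>.\<close>
  hence "((\<lambda>j. f j * (1 / qpoch_inf P P)) has_sum qpoch_inf (- u) P * qpoch_inf (- v) P) UNIV"
  proof (rule has_sum_Sigma')
    show "((\<lambda>r. case (j, r) of (j, r) \<Rightarrow> f j * d j r) has_sum f j * (1 / qpoch_inf P P)) UNIV" for j
      unfolding prod.case d_def by (intro has_sum_cmult_right cauchy_has_sum P)
  qed
  from has_sum_cmult_right[OF this, of "qpoch_inf P P"]
  show ?thesis
    using qpoch_self_tendsto(2)[OF P] by (simp add: f_def P_def mult_ac)
qed

section \<open>Sums over lists of fixed length\<close>

lemma abs_summable_on_lists:
  fixes x :: complex
  assumes x: "norm x < 1"
  shows "(\<lambda>ns. norm (x ^ sum_list ns)) summable_on {ns :: nat list. length ns = k}"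
proof (induction k)
  case 0
  have "{ns :: nat list. length ns = 0} = {[]}" by auto
  thus ?case by simp
next
  case (Suc k)
  have "(\<lambda>(n, ns). norm (x ^ n * x ^ sum_list ns)) summable_on UNIV \<times> {ns :: nat list. length ns = k}"
    by (intro abs_summable_on_times geometric_summable_on x Suc.IH)
  also have "?this \<longleftrightarrow> (\<lambda>ns. norm (x ^ sum_list ns)) summable_on {ns :: nat list. length ns = Suc k}"
    by (rule summable_on_reindex_bij_witness[of _ "\<lambda>ns. (hd ns, tl ns)" "\<lambda>(n, ns). n # ns"])
      (auto simp: power_add length_Suc_conv)
  finally show ?case .
qed

lemma finite_lists_sum: "finite {ns :: nat list. length ns = k \<and> sum_list ns \<le> i}"
proof (rule finite_subset)
  show "{ns :: nat list. length ns = k \<and> sum_list ns \<le> i} \<subseteq> {ns. set ns \<subseteq> {..i} \<and> length ns = k}"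
    using member_le_sum_list order_trans by fastforce
qed (simp add: finite_lists_length_eq)

section \<open>Refined q-trinomial coefficients\<close>

locale half_nome =
  fixes s :: complex
  assumes norm_s: "norm s < 1"
begin

abbreviation Q :: complex where "Q \<equiv> s ^ 6"

lemma norm_Q: "norm Q < 1"
  using norm_power_less_one[OF norm_s, of 6] by simp

abbreviation gbin :: "int \<Rightarrow> int \<Rightarrow> complex" where
  "gbin A B \<equiv> qbinom A B Q"

lemmas pascal = qbinom_pascal[OF norm_Q]
lemmas pascal' = qbinom_pascal'[OF norm_Q]

text \<open>The coefficient of $z^K$ in $1/(z^2;Q)_{A+1}$.\<close>

definition ebinom :: "int \<Rightarrow> int \<Rightarrow> complex" where
  "ebinom A K = (if even K then gbin (A + K div 2) A else 0)"

lemma ebinom_eq_0: "K < 0 \<or> A < 0 \<Longrightarrow> ebinom A K = 0"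
  by (auto simp: ebinom_def qbinom_eq_0)

lemma ebinom_0_right: "A \<ge> 0 \<Longrightarrow> ebinom A 0 = 1"
  by (simp add: ebinom_def qbinom_self norm_Q)

text \<open>Multiplication by 1 - z^2 Q^A cancels the last factor of (z^2;Q)_{A+1}. At
  \<open>A = 0\<close> this leaves the constant 1, whereas \<open>ebinom (-1) K\<close> is always 0;
  \<open>ebinom_0_rec\<close> treats that case.\<close>

lemma ebinom_rec:
  assumes "A \<noteq> 0"
  shows "ebinom A K - Q ^ nat A * ebinom A (K - 2) = ebinom (A - 1) K"
proof (cases "even K")
  case True
  then obtain k where K: "K = 2 * k" by blast
  have "2 * k - 2 = 2 * (k - 1)" by simp
  hence "(2 * k - 2) div 2 = k - 1" by (metis nonzero_mult_div_cancel_left zero_neq_numeral)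
  thus ?thesis
    using pascal'[of "A + k" A] assms by (simp add: ebinom_def K algebra_simps)
qed (simp add: ebinom_def)

lemma ebinom_0_left: "ebinom 0 K = (if even K \<and> K \<ge> 0 then 1 else 0)"
  by (auto simp: ebinom_def qbinom_0_right norm_Q qbinom_eq_0)

lemma ebinom_0_rec: "ebinom 0 K - ebinom 0 (K - 2) = (if K = 0 then 1 else 0)"
proof -
  have "K = 0" if "even K" "K \<ge> 0" "\<not> K - 2 \<ge> 0"
    using that by presburger
  thus ?thesis
    by (auto simp: ebinom_0_left)
qed

section \<open>Recurrences of the refined trinomial coefficients\<close>

definition trinom_gen :: "nat \<Rightarrow> int \<Rightarrow> int \<Rightarrow> int \<Rightarrow> int \<Rightarrow> complex" where
  "trinom_gen M A B L a = (\<Sum>n\<le>M. s ^ (3 * n\<^sup>2) * gbin (int M) (int n)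
     * ebinom A (L - a - int n) * ebinom B (L + a - int n))"

lemma trinom_gen_swap: "trinom_gen M A B L (- a) = trinom_gen M B A L a"
  by (simp add: trinom_gen_def mult_ac)

lemma trinom_gen_eq_0: "A < 0 \<or> B < 0 \<or> L < \<bar>a\<bar> \<Longrightarrow> trinom_gen M A B L a = 0"
  unfolding trinom_gen_def
  by (rule sum.neutral) (smt (verit) ebinom_eq_0 mult_eq_0_iff of_nat_0_le_iff)

text \<open>Cancels the factor 1 - x Q^A of the generating function. A factor x lowers the argument
  of the first \<open>ebinom\<close> alone by 2, which is the move from \<open>(L, a)\<close> to
  \<open>(L - 1, a + 1)\<close>.\<close>

lemma trinom_gen_rec_left:
  assumes "A \<noteq> 0"
  shows "trinom_gen M A B L a - Q ^ nat A * trinom_gen M A B (L - 1) (a + 1) = trinom_gen M (A - 1) B L a"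
proof -
  have "trinom_gen M (A - 1) B L a = (\<Sum>n\<le>M. s ^ (3 * n\<^sup>2) * gbin (int M) (int n)
     * (ebinom A (L - a - int n) - Q ^ nat A * ebinom A (L - a - int n - 2)) * ebinom B (L + a - int n))"
    using ebinom_rec[OF assms] by (simp add: trinom_gen_def)
  also have "\<dots> = trinom_gen M A B L a - Q ^ nat A * trinom_gen M A B (L - 1) (a + 1)"
    unfolding trinom_gen_def sum_distrib_left sum_subtractf[symmetric]
    by (intro sum.cong refl) (simp add: algebra_simps)
  finally show ?thesis by simp
qed

text \<open>The mirror image, cancelling 1 - y Q^B. It survives at \<open>B = 0\<close> when
  \<open>a > 0\<close>: the defect of \<open>ebinom_0_rec\<close> sits at n = L + a, where the other
  \<open>ebinom\<close> has the argument -2a and vanishes. That case is the boundary b = M of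
  \<open>trinom\<close>.\<close>

lemma trinom_gen_rec_right:
  assumes "B \<noteq> 0 \<or> a > 0"
  shows "trinom_gen M A B L a - Q ^ nat B * trinom_gen M A B (L - 1) (a - 1) = trinom_gen M A (B - 1) L a"
proof (cases "B = 0")
  case False
  thus ?thesis
    using trinom_gen_rec_left[of B M A L "- a"] trinom_gen_swap[of M B A L a] trinom_gen_swap[of M B A "L - 1" "a - 1"]
      trinom_gen_swap[of M "B - 1" A L a] by simp
next
  case True
  have "trinom_gen M A B L a - trinom_gen M A B (L - 1) (a - 1) = (\<Sum>n\<le>M. s ^ (3 * n\<^sup>2) * gbin (int M) (int n)
     * ebinom A (L - a - int n) * (ebinom 0 (L + a - int n) - ebinom 0 (L + a - int n - 2)))"
    unfolding trinom_gen_def True sum_subtractf[symmetric]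
    by (intro sum.cong refl) (simp add: algebra_simps)
  also have "\<dots> = 0"
    unfolding ebinom_0_rec using assms True by (intro sum.neutral) (auto simp: ebinom_eq_0)
  finally show ?thesis
    using True by (simp add: trinom_gen_eq_0)
qed

text \<open>Adds the numerator factor 1 + z Q^(M+1/2); its power of \<open>s\<close> is 6M + 3, and
  z lowers \<open>L\<close> by 1 at fixed \<open>a\<close>.\<close>

lemma trinom_gen_Suc: "trinom_gen (Suc M) A B L a = trinom_gen M A B L a + s ^ (6 * M + 3) * trinom_gen M A B (L - 1) a"
proof -
  define h where "h n = ebinom A (L - a - int n) * ebinom B (L + a - int n)" for n
  have e: "nat (1 + int M - int n) = Suc M - n" for n
    by linarith
  have "trinom_gen (Suc M) A B L a = (\<Sum>n\<le>Suc M. s ^ (3 * n\<^sup>2) * gbin (int M) (int n) * h n)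
      + (\<Sum>n\<le>Suc M. s ^ (3 * n\<^sup>2) * Q ^ (Suc M - n) * gbin (int M) (int n - 1) * h n)"
    unfolding trinom_gen_def sum.distrib[symmetric]
    by (intro sum.cong refl, subst pascal) (auto simp: h_def e algebra_simps)
  also have "(\<Sum>n\<le>Suc M. s ^ (3 * n\<^sup>2) * gbin (int M) (int n) * h n) = trinom_gen M A B L a"
    by (simp add: trinom_gen_def h_def qbinom_eq_0 mult_ac)
  also have "(\<Sum>n\<le>Suc M. s ^ (3 * n\<^sup>2) * Q ^ (Suc M - n) * gbin (int M) (int n - 1) * h n)
      = (\<Sum>n\<le>M. s ^ (3 * (Suc n)\<^sup>2) * Q ^ (M - n) * gbin (int M) (int n) * h (Suc n))"
    by (subst sum.atMost_Suc_shift) (simp add: qbinom_eq_0)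
  also have "\<dots> = s ^ (6 * M + 3) * trinom_gen M A B (L - 1) a"
    unfolding trinom_gen_def sum_distrib_left
  proof (intro sum.cong refl)
    fix n assume "n \<in> {..M}"
    hence "3 * (Suc n)\<^sup>2 + 6 * (M - n) = 6 * M + 3 + 3 * n\<^sup>2"
      by (auto simp: power2_eq_square algebra_simps diff_mult_distrib2)
    hence "s ^ (3 * (Suc n)\<^sup>2) * Q ^ (M - n) = s ^ (6 * M + 3) * s ^ (3 * n\<^sup>2)"
      by (simp flip: power_add power_mult)
    thus "s ^ (3 * (Suc n)\<^sup>2) * Q ^ (M - n) * gbin (int M) (int n) * h (Suc n)
      = s ^ (6 * M + 3) * (s ^ (3 * n\<^sup>2) * gbin (int M) (int n)
          * ebinom A (L - 1 - a - int n) * ebinom B (L - 1 + a - int n))"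
      by (simp add: h_def algebra_simps)
  qed
  finally show ?thesis .
qed

text \<open>Warnaar's refined trinomial coefficient in base \<open>Q\<close>. It is embedded in \<open>trinom_gen\<close>, whose
  generating function $(-zQ^{1/2};Q)_M / ((x;Q)_{A+1} (y;Q)_{B+1})$ with $z^2 = xy$ makes the
  recurrences in \<open>M\<close>, \<open>A\<close> and \<open>B\<close> independent of each other.\<close>

definition trinom :: "int \<Rightarrow> nat \<Rightarrow> int \<Rightarrow> int \<Rightarrow> complex" where
  "trinom L M a b = trinom_gen M (int M + b) (int M - b) L a"

lemma trinom_minus: "trinom L M (- a) (- b) = trinom L M a b"
  by (simp add: trinom_def trinom_gen_swap)

lemma trinom_eq_0: "int M < \<bar>b\<bar> \<or> L < \<bar>a\<bar> \<Longrightarrow> trinom L M a b = 0"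
  unfolding trinom_def by (rule trinom_gen_eq_0) linarith

text \<open>Both sides are \<open>trinom_gen\<close> with orders M + b and M - b - 1, reached from
  \<open>b + 1\<close> by cancelling a factor in x and from \<open>b\<close> by cancelling a factor
  in y.\<close>

lemma trinom_shift:
  assumes "a > 0"
  shows "trinom L M a (int b + 1) - Q ^ (M + b + 1) * trinom (L - 1) M (a + 1) (int b + 1)
       = trinom L M a (int b) - Q ^ (M - b) * trinom (L - 1) M (a - 1) (int b)"
proof -
  have e: "nat (int M + (int b + 1)) = M + b + 1" "nat (int M - int b) = M - b" by auto
  have "trinom L M a (int b + 1) - Q ^ (M + b + 1) * trinom (L - 1) M (a + 1) (int b + 1)
      = trinom_gen M (int M + int b) (int M - int b - 1) L a"
    using trinom_gen_rec_left[of "int M + (int b + 1)" M "int M - (int b + 1)" L a]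
    unfolding trinom_def e by (simp add: algebra_simps)
  also have "\<dots> = trinom L M a (int b) - Q ^ (M - b) * trinom (L - 1) M (a - 1) (int b)"
    using trinom_gen_rec_right[of "int M - int b" a M "int M + int b" L] assms
    unfolding trinom_def e by simp
  finally show ?thesis .
qed

text \<open>\<open>V\<close> has orders M + b + 1 and M - b, within two factors of each coefficient
  with parameters \<open>M\<close> or \<open>M + 1\<close> and \<open>b\<close> or
  \<open>b + 1\<close>. Written through \<open>V\<close>, both sides reduce to Q^(M+b+1) V(L-1,c) +
  s^(6M+3) V(L-1,c-1); the prefactor s^(6b+3) matches the numerator term of one side with the
  cancellation term of the other.\<close>

lemma trinom_exchange:
  assumes "c > 1"
  shows "s ^ (6 * b + 3) * (trinom L (Suc M) c (int b + 1) - trinom L M c (int b + 1)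
            - Q ^ (Suc M + b + 1) * trinom (L - 1) (Suc M) (c + 1) (int b + 1))
       = trinom L (Suc M) (c - 1) (int b) - trinom L M (c - 1) (int b)
            - Q ^ (Suc M - b) * trinom (L - 1) (Suc M) (c - 2) (int b)"
proof -
  define V where "V = trinom_gen M (int M + int b + 1) (int M - int b)"
  have e: "nat (int M + int b + 1) = M + b + 1" "nat (int M - int b) = M - b"
      "nat (int (Suc M) + (int b + 1)) = Suc M + b + 1" "nat (int (Suc M) - int b) = Suc M - b"
    by auto
  have 1: "trinom L (Suc M) c (int b + 1) - Q ^ (Suc M + b + 1) * trinom (L - 1) (Suc M) (c + 1) (int b + 1)
      = V L c + s ^ (6 * M + 3) * V (L - 1) c"
    using trinom_gen_rec_left[of "int (Suc M) + (int b + 1)" "Suc M" "int (Suc M) - (int b + 1)" L c]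
      trinom_gen_Suc[of M "int M + int b + 1" "int M - int b" L c]
    unfolding trinom_def e V_def by (simp add: algebra_simps)
  have 2: "trinom L M c (int b + 1) = V L c - Q ^ (M - b) * V (L - 1) (c - 1)"
    using trinom_gen_rec_right[of "int M - int b" c M "int M + int b + 1" L] assms
    unfolding trinom_def e V_def by (simp add: algebra_simps)
  have 3: "trinom L (Suc M) (c - 1) (int b) - Q ^ (Suc M - b) * trinom (L - 1) (Suc M) (c - 2) (int b)
      = V L (c - 1) + s ^ (6 * M + 3) * V (L - 1) (c - 1)"
    using trinom_gen_rec_right[of "int (Suc M) - int b" "c - 1" "Suc M" "int (Suc M) + int b" L] assms
      trinom_gen_Suc[of M "int M + int b + 1" "int M - int b" L "c - 1"]
    unfolding trinom_def e V_def by (simp add: algebra_simps)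
  have 4: "trinom L M (c - 1) (int b) = V L (c - 1) - Q ^ (M + b + 1) * V (L - 1) c"
    using trinom_gen_rec_left[of "int M + int b + 1" M "int M - int b" L "c - 1"]
    unfolding trinom_def e V_def by (simp add: algebra_simps)
  \<comment> \<open>For \<open>b > M\<close> the subtraction \<open>M - b\<close> truncates, but
    then the second order of \<open>V\<close> is negative and \<open>V\<close> vanishes.\<close>
  have 5: "s ^ (6 * b + 3) * (Q ^ (M - b) * V (L - 1) (c - 1)) = s ^ (6 * M + 3) * V (L - 1) (c - 1)"
  proof (cases "b \<le> M")
    case True
    have "s ^ (6 * b + 3) * Q ^ (M - b) = s ^ (6 * b + 3 + 6 * (M - b))"
      by (simp add: power_add power_mult)
    also have "6 * b + 3 + 6 * (M - b) = 6 * M + 3"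
      using True by simp
    finally show ?thesis by (simp flip: mult.assoc)
  qed (simp add: V_def trinom_gen_eq_0)
  have 6: "s ^ (6 * b + 3) * (s ^ (6 * M + 3) * V (L - 1) c) = Q ^ (M + b + 1) * V (L - 1) c"
    by (simp add: algebra_simps flip: power_add power_mult mult.assoc)
  have comb: "t - m - q = v1 + v2" if "t - q = v + v1" "m = v - v2" for t m q v v1 v2 :: complex
    using that by algebra
  have "s ^ (6 * b + 3) * (trinom L (Suc M) c (int b + 1) - trinom L M c (int b + 1)
            - Q ^ (Suc M + b + 1) * trinom (L - 1) (Suc M) (c + 1) (int b + 1))
      = s ^ (6 * b + 3) * (s ^ (6 * M + 3) * V (L - 1) c) + s ^ (6 * b + 3) * (Q ^ (M - b) * V (L - 1) (c - 1))"
    unfolding comb[OF 1 2] by (rule distrib_left)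
  also have "\<dots> = trinom L (Suc M) (c - 1) (int b) - trinom L M (c - 1) (int b)
            - Q ^ (Suc M - b) * trinom (L - 1) (Suc M) (c - 2) (int b)"
    unfolding 5 6 comb[OF 3 4] by (rule add.commute)
  finally show ?thesis .
qed

text \<open>For \<open>b = 0\<close> the generating functions satisfy (1 - xQ^(M+1)) (1 - yQ^(M+1))
  F_{M+1} = (1 + zQ^(M+1/2)) F_M, and xy = z^2 lowers \<open>L\<close> by 2. So \<open>b\<close>
  stays 0 and the recurrence is closed.\<close>

lemma trinom_rec_b0:
  "trinom L (Suc M) a 0 - Q ^ Suc M * trinom (L - 1) (Suc M) (a + 1) 0 - Q ^ Suc M * trinom (L - 1) (Suc M) (a - 1) 0
     + Q ^ (2 * Suc M) * trinom (L - 2) (Suc M) a 0 = trinom L M a 0 + s ^ (6 * M + 3) * trinom (L - 1) M a 0"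
proof -
  define m where "m = int (Suc M)"
  have m: "m \<noteq> 0" "nat m = Suc M" "m - 1 = int M" by (auto simp: m_def)
  have 1: "trinom L (Suc M) a 0 - Q ^ Suc M * trinom (L - 1) (Suc M) (a + 1) 0 = trinom_gen (Suc M) (m - 1) m L a"
    using trinom_gen_rec_left[of m "Suc M" m L a] m unfolding trinom_def by (simp add: m_def)
  have 2: "trinom (L - 1) (Suc M) (a - 1) 0 - Q ^ Suc M * trinom (L - 2) (Suc M) a 0 = trinom_gen (Suc M) (m - 1) m (L - 1) (a - 1)"
    using trinom_gen_rec_left[of m "Suc M" m "L - 1" "a - 1"] m unfolding trinom_def by (simp add: m_def)
  have 3: "trinom_gen (Suc M) (m - 1) m L a - Q ^ Suc M * trinom_gen (Suc M) (m - 1) m (L - 1) (a - 1)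
      = trinom L M a 0 + s ^ (6 * M + 3) * trinom (L - 1) M a 0"
    using trinom_gen_rec_right[of m a "Suc M" "m - 1" L] trinom_gen_Suc[of M "m - 1" "m - 1" L a] m
    unfolding trinom_def by simp
  have "trinom L (Suc M) a 0 - Q ^ Suc M * trinom (L - 1) (Suc M) (a + 1) 0 - Q ^ Suc M * trinom (L - 1) (Suc M) (a - 1) 0
     + Q ^ (2 * Suc M) * trinom (L - 2) (Suc M) a 0 = 
     (trinom L (Suc M) a 0 - Q ^ Suc M * trinom (L - 1) (Suc M) (a + 1) 0) - Q ^ Suc M * 
     (trinom (L - 1) (Suc M) (a - 1) 0 - Q ^ Suc M * trinom (L - 2) (Suc M) a 0)"
    by (simp only: mult_2 power_add) (simp only: algebra_simps)
  thus ?thesis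
    unfolding 1 2 3 .
qed

text \<open>Here F_0 = 1 / ((1 - x)(1 - y)), so the same combination picks out the coefficients of
  the constant 1.\<close>

lemma trinom_rec_0_0:
  "trinom L 0 a 0 - trinom (L - 1) 0 (a + 1) 0 - trinom (L - 1) 0 (a - 1) 0 + trinom (L - 2) 0 a 0
     = (if L = 0 \<and> a = 0 then 1 else 0)"
proof -
  have trinom: "trinom L 0 a 0 = ebinom 0 (L - a) * ebinom 0 (L + a)" for L a
    by (simp add: trinom_def trinom_gen_def qbinom_0_right norm_Q)
  have "trinom L 0 a 0 - trinom (L - 1) 0 (a + 1) 0 - trinom (L - 1) 0 (a - 1) 0 + trinom (L - 2) 0 a 0
      = (ebinom 0 (L - a) - ebinom 0 (L - a - 2)) * (ebinom 0 (L + a) - ebinom 0 (L + a - 2))"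
    unfolding trinom by (simp add: algebra_simps)
  thus ?thesis
    unfolding ebinom_0_rec by auto
qed

section \<open>The transformation of the refined trinomial coefficients\<close>

definition burge :: "int \<Rightarrow> int \<Rightarrow> int \<Rightarrow> nat \<Rightarrow> complex" where
  "burge a b L M = (\<Sum>r\<le>M. s ^ (3 * r\<^sup>2) * gbin (L + int M - int r) L * trinom (L - int r) r a b)"

lemma burge_eq_0: "L < 0 \<Longrightarrow> burge a b L M = 0"
  unfolding burge_def by (rule sum.neutral) (auto simp: qbinom_eq_0)

text \<open>The added term has upper index \<open>L - 1\<close>, below the lower index
  \<open>L\<close>. The sums for \<open>M\<close> and \<open>M + 1\<close> thereby get the same
  range and can be subtracted termwise.\<close>

lemma burge_extend: "burge a b L M
    = (\<Sum>r\<le>Suc M. s ^ (3 * r\<^sup>2) * gbin (L + int M - int r) L * trinom (L - int r) r a b)"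
  by (simp add: burge_def qbinom_eq_0)

lemma gbin_diff:
  assumes "L > 0" "r \<le> M"
  shows "gbin (L + int M - int r) L - gbin (L + int M - int r - 1) L
    = Q ^ (M - r) * gbin (L - 1 + int M - int r) (L - 1)"
  using pascal[of "L + int M - int r" L] assms
  by (simp add: algebra_simps nat_diff_distrib)

text \<open>This is the recurrence of \<open>trinom_rec_b0\<close>, transported through the sum.
  \<open>gbin_diff\<close> produces Q^(M'-r), which turns the coefficients Q^M' into Q^r, and the
  bracket \<open>br r\<close> then collapses by the recurrence of \<open>trinom\<close> in its own
  second argument \<open>r\<close>. Shifting \<open>r\<close> by one gives the right side.\<close>

lemma burge_rec_b0:
  assumes L: "L > 0"
  shows "burge a 0 L (Suc M) - Q ^ Suc M * burge (a + 1) 0 (L - 1) (Suc M) - Q ^ Suc M * burge (a - 1) 0 (L - 1) (Suc M)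
     + Q ^ (2 * Suc M) * burge a 0 (L - 2) (Suc M) = burge a 0 L M + s ^ (6 * M + 3) * burge a 0 (L - 1) M"
proof -
  define M' where "M' = Suc M"
  define P where "P r = gbin (L - 1 + int M' - int r) (L - 1)" for r
  define w where "w r = s ^ (3 * r\<^sup>2)" for r :: nat
  define br where "br r = trinom (L - int r) r a 0 - Q ^ r * trinom (L - 1 - int r) r (a + 1) 0
      - Q ^ r * trinom (L - 1 - int r) r (a - 1) 0 + Q ^ (2 * r) * trinom (L - 2 - int r) r a 0" for r
  \<comment> \<open>The defect from writing the binomial with lower index \<open>L - 2\<close>
    through the common factor \<open>P r\<close>. It cancels against the second part of
    \<open>br (Suc r)\<close> once \<open>r\<close> is shifted.\<close>
  define E where "E r = w r * Q ^ (M' + r) * gbin (L - 1 + int M - int r) (L - 1) * trinom (L - 2 - int r) r a 0" for r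
  \<comment> \<open>The exceptional value in \<open>trinom_rec_0_0\<close> occurs only at
    \<open>L = 0\<close>.\<close>
  have br0: "br 0 = 0"
    using trinom_rec_0_0[of L a] L by (simp add: br_def)
  have brS: "br (Suc r) = trinom (L - 1 - int r) r a 0 + s ^ (6 * r + 3) * trinom (L - 2 - int r) r a 0" for r
    using trinom_rec_b0[of "L - int (Suc r)" r a] by (simp add: br_def algebra_simps)
  have "burge a 0 L M' - Q ^ M' * burge (a + 1) 0 (L - 1) M' - Q ^ M' * burge (a - 1) 0 (L - 1) M'
     + Q ^ (2 * M') * burge a 0 (L - 2) M' - burge a 0 L M
     = (\<Sum>r\<le>M'. w r * ((gbin (L + int M' - int r) L - gbin (L + int M' - int r - 1) L) * trinom (L - int r) r a 0
         - Q ^ M' * P r * (trinom (L - 1 - int r) r (a + 1) 0 + trinom (L - 1 - int r) r (a - 1) 0)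
         + Q ^ (2 * M') * gbin (L - 2 + int M' - int r) (L - 2) * trinom (L - 2 - int r) r a 0))"
    unfolding burge_extend[of a 0 L M] unfolding burge_def M'_def sum_distrib_left sum_subtractf[symmetric] sum.distrib[symmetric]
    by (intro sum.cong refl) (simp add: P_def w_def M'_def algebra_simps)
  also have "\<dots> = (\<Sum>r\<le>M'. w r * Q ^ (M' - r) * P r * br r - E r)"
  proof (intro sum.cong refl)
    fix r assume "r \<in> {..M'}"
    hence r: "r \<le> M'" by simp
    have q: "Q ^ M' = Q ^ (M' - r) * Q ^ r"
      using r by (simp flip: power_add)
    have q2: "Q ^ (M' - r) * Q ^ (2 * r) = Q ^ (M' + r)" "Q ^ (M' + r) * Q ^ (M' - r) = Q ^ (2 * M')"
      using r by (simp_all add: ac_simps mult_2 mult_2_right flip: power_add)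
    \<comment> \<open>\<open>gbin_diff\<close> at \<open>L - 1\<close> covers \<open>L > 1\<close>;
      at \<open>L = 1\<close> the \<open>trinom\<close> factor has a negative first argument and
      vanishes.\<close>
    have "(P r - gbin (L - 1 + int M - int r) (L - 1)
        - Q ^ (M' - r) * gbin (L - 2 + int M' - int r) (L - 2)) * trinom (L - 2 - int r) r a 0 = 0"
    proof (cases "L = 1")
      case False
      thus ?thesis
        using gbin_diff[of "L - 1" r M'] L r by (simp add: P_def M'_def algebra_simps)
    qed (simp add: trinom_eq_0)
    hence "Q ^ (M' + r) * (P r * trinom (L - 2 - int r) r a 0)
        = Q ^ (M' + r) * gbin (L - 1 + int M - int r) (L - 1) * trinom (L - 2 - int r) r a 0
          + (Q ^ (M' + r) * Q ^ (M' - r)) * gbin (L - 2 + int M' - int r) (L - 2) * trinom (L - 2 - int r) r a 0"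
      by (simp add: algebra_simps)
    hence z: "Q ^ (2 * M') * gbin (L - 2 + int M' - int r) (L - 2) * trinom (L - 2 - int r) r a 0
        = (Q ^ (M' - r) * Q ^ (2 * r)) * (P r * trinom (L - 2 - int r) r a 0)
        - Q ^ (M' + r) * gbin (L - 1 + int M - int r) (L - 1) * trinom (L - 2 - int r) r a 0"
      unfolding q2 by simp
    show "w r * ((gbin (L + int M' - int r) L - gbin (L + int M' - int r - 1) L) * trinom (L - int r) r a 0
         - Q ^ M' * P r * (trinom (L - 1 - int r) r (a + 1) 0 + trinom (L - 1 - int r) r (a - 1) 0)
         + Q ^ (2 * M') * gbin (L - 2 + int M' - int r) (L - 2) * trinom (L - 2 - int r) r a 0)
       = w r * Q ^ (M' - r) * P r * br r - E r"
      unfolding z gbin_diff[OF L r] q P_def[symmetric] br_def E_def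
      by (simp add: algebra_simps)
  qed
  also have "\<dots> = (\<Sum>r\<le>M'. w r * Q ^ (M' - r) * P r * br r) - (\<Sum>r\<le>M'. E r)"
    by (rule sum_subtractf)
  also have "(\<Sum>r\<le>M'. E r) = (\<Sum>r\<le>M. E r)"
    by (simp add: M'_def E_def qbinom_eq_0)
  also have "(\<Sum>r\<le>M'. w r * Q ^ (M' - r) * P r * br r)
      = (\<Sum>r\<le>M. w (Suc r) * Q ^ (M - r) * P (Suc r) * br (Suc r))"
    unfolding M'_def by (subst sum.atMost_Suc_shift) (simp add: br0)
  also have "\<dots> = s ^ (6 * M + 3) * burge a 0 (L - 1) M + (\<Sum>r\<le>M. E r)"
    unfolding burge_def sum_distrib_left sum.distrib[symmetric]
  proof (intro sum.cong refl)
    fix r assume "r \<in> {..M}"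
    hence e: "3 * (Suc r)\<^sup>2 + 6 * (M - r) = 6 * M + 3 + 3 * r\<^sup>2"
      by (auto simp: power2_eq_square algebra_simps diff_mult_distrib2)
    have 1: "w (Suc r) * Q ^ (M - r) = s ^ (6 * M + 3) * w r"
      unfolding w_def power_mult[symmetric] power_add[symmetric] e ..
    have 2: "s ^ (6 * M + 3) * w r * s ^ (6 * r + 3) = w r * Q ^ (M' + r)"
      unfolding w_def power_mult[symmetric] power_add[symmetric] M'_def
      by (rule arg_cong[where f = "\<lambda>n. s ^ n"]) simp
    have 3: "P (Suc r) = gbin (L - 1 + int M - int r) (L - 1)"
      by (simp add: P_def M'_def algebra_simps)
    have "w (Suc r) * Q ^ (M - r) * P (Suc r) * br (Suc r)
       = s ^ (6 * M + 3) * w r * P (Suc r) * trinom (L - 1 - int r) r a 0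
         + (s ^ (6 * M + 3) * w r * s ^ (6 * r + 3)) * P (Suc r) * trinom (L - 2 - int r) r a 0"
      unfolding 1 brS by (simp add: algebra_simps)
    thus "w (Suc r) * Q ^ (M - r) * P (Suc r) * br (Suc r)
       = s ^ (6 * M + 3) * (s ^ (3 * r\<^sup>2) * gbin (L - 1 + int M - int r) (L - 1) * trinom (L - 1 - int r) r a 0) + E r"
      unfolding 2 unfolding E_def 3 by (simp add: w_def algebra_simps)
  qed
  finally show ?thesis
    by (simp add: M'_def algebra_simps)
qed

lemma burge_0_right: "burge a b L 0 = (if L \<ge> 0 then trinom L 0 a b else 0)"
  by (auto simp: burge_def qbinom_self norm_Q qbinom_eq_0)

lemma trinom_0_left: "trinom 0 M a 0 = (if a = 0 then 1 else 0)"
proof (cases "a = 0")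
  case True
  have "trinom 0 M 0 0 = (\<Sum>n\<le>M. if n = 0 then 1 else 0)"
    unfolding trinom_def trinom_gen_def
    by (intro sum.cong refl) (auto simp: ebinom_eq_0 ebinom_0_right qbinom_0_right norm_Q)
  thus ?thesis using True by simp
qed (simp add: trinom_eq_0)

lemma burge_0_left: "burge a 0 0 M = (if a = 0 then 1 else 0)"
proof -
  have "burge a 0 0 M = (\<Sum>r\<le>M. if r = 0 then (if a = 0 then 1 else 0) else 0)"
    unfolding burge_def
    by (intro sum.cong refl) (auto simp: trinom_eq_0 trinom_0_left qbinom_0_right norm_Q)
  thus ?thesis by simp
qed

text \<open>Both sides obey one recurrence, which determines the value at \<open>Suc M\<close> from
  values at \<open>M\<close> and from smaller \<open>L\<close>, with \<open>a\<close> moving. Hence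
  an outer induction on \<open>M\<close>, an inner one on \<open>L\<close>, and agreement at
  \<open>M = 0\<close> and \<open>L \<le> 0\<close>.\<close>

lemma burge_b0: "burge a 0 L M = trinom L M a 0"
proof (induction M arbitrary: a L)
  case 0
  show ?case by (simp add: burge_0_right trinom_eq_0)
next
  case (Suc M)
  note IHM = this
  show ?case
  proof (induction "nat L" arbitrary: a L rule: less_induct)
    case less
    consider "L < 0" | "L = 0" | "L > 0" by linarith
    thus ?case
    proof cases
      case 3
      have IH: "burge a' 0 (L - 1) (Suc M) = trinom (L - 1) (Suc M) a' 0" for a'
        using less[of "L - 1"] 3 by simp
      have IH2: "burge a' 0 (L - 2) (Suc M) = trinom (L - 2) (Suc M) a' 0" for a'
        using less[of "L - 2"] 3 by simp
      show ?thesis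
        using burge_rec_b0[OF 3, of a M, unfolded IHM IH IH2 trinom_rec_b0[of L M a, symmetric]] by simp
    qed (simp_all add: burge_eq_0 trinom_eq_0 burge_0_left trinom_0_left)
  qed
qed

text \<open>A mixed difference in \<open>M\<close> and \<open>b\<close>: the difference in
  \<open>M\<close> yields Q^(M'-r) by \<open>gbin_diff\<close>, the one in \<open>b\<close> is
  \<open>trinom_shift\<close> at second argument \<open>r\<close>. The powers of \<open>Q\<close>
  combine to powers free of \<open>r\<close>, so sums of type \<open>burge\<close> reappear.\<close>

lemma burge_rec:
  assumes L: "L > 0" and a: "a > 0"
  shows "burge a (int b + 1) L (Suc M) - burge a (int b + 1) L M - burge a (int b) L (Suc M) + burge a (int b) L M
    = Q ^ (Suc M + b + 1) * burge (a + 1) (int b + 1) (L - 1) (Suc M)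
      - Q ^ (Suc M - b) * burge (a - 1) (int b) (L - 1) (Suc M)"
proof -
  define M' where "M' = Suc M"
  define P where "P r = gbin (L - 1 + int M' - int r) (L - 1)" for r
  define w where "w r = s ^ (3 * r\<^sup>2)" for r :: nat
  have "burge a (int b + 1) L M' - burge a (int b + 1) L M - burge a (int b) L M' + burge a (int b) L M
     = (\<Sum>r\<le>M'. w r * (gbin (L + int M' - int r) L - gbin (L + int M' - int r - 1) L)
         * (trinom (L - int r) r a (int b + 1) - trinom (L - int r) r a (int b)))"
    unfolding burge_extend[of a _ L M] unfolding burge_def M'_def sum_distrib_left sum_subtractf[symmetric] sum.distrib[symmetric]
    by (intro sum.cong refl) (simp add: P_def w_def M'_def algebra_simps)
  also have "\<dots> = (\<Sum>r\<le>M'. w r * P r * (Q ^ (M' + b + 1) * trinom (L - 1 - int r) r (a + 1) (int b + 1)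
         - Q ^ (M' - b) * trinom (L - 1 - int r) r (a - 1) (int b)))"
  proof (intro sum.cong refl)
    fix r assume "r \<in> {..M'}"
    hence r: "r \<le> M'" by simp
    have sh: "trinom (L - int r) r a (int b + 1) - trinom (L - int r) r a (int b)
      = Q ^ (r + b + 1) * trinom (L - 1 - int r) r (a + 1) (int b + 1) - Q ^ (r - b) * trinom (L - 1 - int r) r (a - 1) (int b)"
      using trinom_shift[OF a, of "L - int r" r b] by (simp add: algebra_simps)
    have 1: "Q ^ (M' - r) * Q ^ (r + b + 1) = Q ^ (M' + b + 1)"
      unfolding power_add[symmetric] using r by simp
    have 2: "Q ^ (M' - r) * (Q ^ (r - b) * trinom (L - 1 - int r) r (a - 1) (int b))
        = Q ^ (M' - b) * trinom (L - 1 - int r) r (a - 1) (int b)"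
    proof (cases "b \<le> r")
      case True
      hence "Q ^ (M' - r) * Q ^ (r - b) = Q ^ (M' - b)"
        unfolding power_add[symmetric] using r by simp
      thus ?thesis by (simp flip: mult.assoc)
    qed (simp add: trinom_eq_0)
    have "Q ^ (M' - r) * (trinom (L - int r) r a (int b + 1) - trinom (L - int r) r a (int b))
       = (Q ^ (M' - r) * Q ^ (r + b + 1)) * trinom (L - 1 - int r) r (a + 1) (int b + 1)
         - Q ^ (M' - r) * (Q ^ (r - b) * trinom (L - 1 - int r) r (a - 1) (int b))"
      unfolding sh by (simp only: right_diff_distrib mult.assoc)
    hence "Q ^ (M' - r) * (trinom (L - int r) r a (int b + 1) - trinom (L - int r) r a (int b))
       = Q ^ (M' + b + 1) * trinom (L - 1 - int r) r (a + 1) (int b + 1)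
         - Q ^ (M' - b) * trinom (L - 1 - int r) r (a - 1) (int b)"
      unfolding 1 2 .
    thus "w r * (gbin (L + int M' - int r) L - gbin (L + int M' - int r - 1) L)
         * (trinom (L - int r) r a (int b + 1) - trinom (L - int r) r a (int b))
      = w r * P r * (Q ^ (M' + b + 1) * trinom (L - 1 - int r) r (a + 1) (int b + 1)
         - Q ^ (M' - b) * trinom (L - 1 - int r) r (a - 1) (int b))"
      unfolding gbin_diff[OF L r] P_def[symmetric] by (metis mult.assoc mult.left_commute)
  qed
  also have "\<dots> = Q ^ (M' + b + 1) * burge (a + 1) (int b + 1) (L - 1) M'
      - Q ^ (M' - b) * burge (a - 1) (int b) (L - 1) M'"
    unfolding burge_def sum_distrib_left sum_subtractf[symmetric]
    by (intro sum.cong refl) (simp add: P_def w_def algebra_simps)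
  finally show ?thesis
    unfolding M'_def .
qed

text \<open>The restriction \<open>b \<le> a\<close> keeps the induction inside the region where \<open>trinom_shift\<close> and
  \<open>trinom_exchange\<close> hold.\<close>

lemma trinom_transform:
  "int b \<le> a \<Longrightarrow> burge a (int b) L M = s ^ (3 * b\<^sup>2) * trinom L M (a + int b) (int b)"
proof (induction b arbitrary: a L M)
  case 0
  show ?case by (simp add: burge_b0)
next
  case (Suc b)
  note IHb = Suc.IH
  have c: "int (Suc b) = int b + 1" by simp
  define W where "W = s ^ (3 * b\<^sup>2)"
  have W: "s ^ (3 * (Suc b)\<^sup>2) = W * s ^ (6 * b + 3)"
    unfolding W_def power_add[symmetric]
    by (rule arg_cong[where f = "\<lambda>n. s ^ n"]) (simp add: power2_eq_square)
  show ?case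
    using Suc.prems unfolding c W
  proof (induction M arbitrary: a L)
    case 0
    thus ?case by (simp add: burge_0_right trinom_eq_0)
  next
    case (Suc M)
    note IHM = Suc.IH
    show ?case
      using Suc.prems
    proof (induction "nat L" arbitrary: a L rule: less_induct)
      case less
      show ?case
      proof (cases "L > 0")
        case False
        have "burge a (int b + 1) L (Suc M) = 0"
          unfolding burge_def using False less.prems by (intro sum.neutral) (auto simp: trinom_eq_0)
        thus ?thesis
          using False less.prems by (simp add: trinom_eq_0)
      next
        case True
        \<comment> \<open>The claimed right side has first parameter a + b + 1, so
          \<open>trinom_exchange\<close> is taken at c = a + b + 1.\<close>
        have a: "a > 0" "a + int b + 1 > 1"
          using less.prems by auto
        have 1: "burge (a + 1) (int b + 1) (L - 1) (Suc M)
            = W * s ^ (6 * b + 3) * trinom (L - 1) (Suc M) (a + int b + 1 + 1) (int b + 1)"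
          using less.hyps[of "L - 1" "a + 1"] less.prems True by (simp add: algebra_simps)
        have 2: "burge a (int b + 1) L M = W * s ^ (6 * b + 3) * trinom L M (a + int b + 1) (int b + 1)"
          using IHM[of a L] less.prems by (simp add: algebra_simps)
        have 3: "burge a (int b) L M' = W * trinom L M' (a + int b + 1 - 1) (int b)" for M'
          using IHb[of a L M'] less.prems by (simp add: W_def)
        have 4: "burge (a - 1) (int b) (L - 1) (Suc M) = W * trinom (L - 1) (Suc M) (a + int b + 1 - 2) (int b)"
          using IHb[of "a - 1" "L - 1" "Suc M"] less.prems by (simp add: W_def algebra_simps)
        have 5: "W * (s ^ (6 * b + 3) * (trinom L (Suc M) (a + int b + 1) (int b + 1) - trinom L M (a + int b + 1) (int b + 1)
            - Q ^ (Suc M + b + 1) * trinom (L - 1) (Suc M) (a + int b + 1 + 1) (int b + 1)))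
          = W * (trinom L (Suc M) (a + int b + 1 - 1) (int b) - trinom L M (a + int b + 1 - 1) (int b)
            - Q ^ (Suc M - b) * trinom (L - 1) (Suc M) (a + int b + 1 - 2) (int b))"
          unfolding trinom_exchange[OF a(2)] ..
        \<comment> \<open>After the induction hypotheses are inserted, \<open>burge_rec\<close> and
          the exchange relation scaled by \<open>W\<close> share all terms except the two to be
          compared, at \<open>(L, Suc M)\<close>; subtraction identifies these.\<close>
        have eq: "x = w * z * t"
          if "x - w * z * m - w * ta + w * tb = qc * (w * z * c) - qd * (w * d)"
            and "w * (z * (t - m - qc * c)) = w * (ta - tb - qd * d)"
          for x w z m ta tb qc c qd d t :: complex
          using that by algebra
        show ?thesis
          unfolding add.assoc[symmetric] by (rule eq[OF burge_rec[OF True a(1), of b M, unfolded 1 2 3 4] 5])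
      qed
    qed
  qed
qed

section \<open>The cubic base identity\<close>

text \<open>Both sides satisfy the same recurrence in \<open>A\<close> and \<open>k\<close>, with
  \<open>B\<close> fixed and \<open>j\<close> raised in one term. On the left it comes from Pascal's
  rule for the last and then the first binomial, on the right from Pascal's rule for both factors.
  The boundaries are \<open>A = 0\<close> and \<open>k = 0\<close>.\<close>

lemma q_saalschuetz:
  "(\<Sum>t\<le>k. Q ^ (t * (t + j)) * gbin (int A) (int t) * gbin (int B) (int (t + j))
      * gbin (int (A + B + k) - int t) (int k - int t))
   = gbin (int (A + k + j)) (int k) * gbin (int (B + k)) (int (k + j))"
proof -
  define S where "S A j k = (\<Sum>t\<le>k. Q ^ (t * (t + j)) * gbin (int A) (int t) * gbin (int B) (int (t + j))
      * gbin (int (A + B + k) - int t) (int k - int t))" for A j k :: nat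
  define R where "R A j k = gbin (int (A + k + j)) (int k) * gbin (int (B + k)) (int (k + j))" for A j k :: nat
  have S_rec: "S (Suc A) j (Suc k) = Q ^ (Suc A + B) * S (Suc A) j k + S A j (Suc k)
      + Q ^ (Suc A + j) * S A (Suc j) k" for A j k
  proof -
    define w where "w t = Q ^ (t * (t + j)) * gbin (int B) (int (t + j))" for t
    have p1: "gbin (int (Suc A + B + Suc k) - int t) (int (Suc k) - int t)
        = gbin (int (A + B + Suc k) - int t) (int (Suc k) - int t)
        + Q ^ (Suc A + B) * gbin (int (Suc A + B + k) - int t) (int k - int t)" for t
    proof -
      have "nat (int (Suc A + B + Suc k) - int t - (int (Suc k) - int t)) = Suc A + B" by simp
      thus ?thesis
        using pascal[of "int (Suc A + B + Suc k) - int t" "int (Suc k) - int t"]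
        by (simp add: algebra_simps)
    qed
    have p2: "gbin (int (Suc A)) (int t) = gbin (int A) (int t) + Q ^ (Suc A - t) * gbin (int A) (int t - 1)" for t
    proof -
      have "nat (int (Suc A) - int t) = Suc A - t" by linarith
      thus ?thesis
        using pascal[of "int (Suc A)" "int t"] by simp
    qed
    have "S (Suc A) j (Suc k)
        = (\<Sum>t\<le>Suc k. w t * gbin (int (Suc A)) (int t) * gbin (int (A + B + Suc k) - int t) (int (Suc k) - int t))
        + Q ^ (Suc A + B) * (\<Sum>t\<le>Suc k. w t * gbin (int (Suc A)) (int t) * gbin (int (Suc A + B + k) - int t) (int k - int t))"
      unfolding S_def p1 sum_distrib_left sum.distrib[symmetric]
      by (intro sum.cong refl) (simp add: w_def algebra_simps)
    also have "(\<Sum>t\<le>Suc k. w t * gbin (int (Suc A)) (int t) * gbin (int (Suc A + B + k) - int t) (int k - int t))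
        = S (Suc A) j k"
      by (simp add: S_def w_def qbinom_eq_0 mult_ac)
    also have "(\<Sum>t\<le>Suc k. w t * gbin (int (Suc A)) (int t) * gbin (int (A + B + Suc k) - int t) (int (Suc k) - int t))
        = (\<Sum>t\<le>Suc k. w t * gbin (int A) (int t) * gbin (int (A + B + Suc k) - int t) (int (Suc k) - int t))
        + (\<Sum>t\<le>Suc k. w t * Q ^ (Suc A - t) * gbin (int A) (int t - 1) * gbin (int (A + B + Suc k) - int t) (int (Suc k) - int t))"
      unfolding p2 sum.distrib[symmetric] by (intro sum.cong refl) (simp add: algebra_simps)
    also have "(\<Sum>t\<le>Suc k. w t * gbin (int A) (int t) * gbin (int (A + B + Suc k) - int t) (int (Suc k) - int t)) = S A j (Suc k)"
      unfolding S_def w_def by (intro sum.cong refl) (simp add: mult_ac)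
    also have "(\<Sum>t\<le>Suc k. w t * Q ^ (Suc A - t) * gbin (int A) (int t - 1) * gbin (int (A + B + Suc k) - int t) (int (Suc k) - int t))
        = (\<Sum>t\<le>k. w (Suc t) * Q ^ (A - t) * gbin (int A) (int t) * gbin (int (A + B + k) - int t) (int k - int t))"
      by (subst sum.atMost_Suc_shift) (simp add: qbinom_eq_0)
    also have "\<dots> = Q ^ (Suc A + j) * S A (Suc j) k"
      unfolding S_def sum_distrib_left
    proof (intro sum.cong refl)
      fix t
      show "w (Suc t) * Q ^ (A - t) * gbin (int A) (int t) * gbin (int (A + B + k) - int t) (int k - int t)
          = Q ^ (Suc A + j) * (Q ^ (t * (t + Suc j)) * gbin (int A) (int t) * gbin (int B) (int (t + Suc j))
             * gbin (int (A + B + k) - int t) (int k - int t))"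
      proof (cases "t \<le> A")
        case True
        hence "Suc t * (Suc t + j) + (A - t) = Suc A + j + t * (t + Suc j)"
          by (simp add: algebra_simps)
        hence "Q ^ (Suc t * (Suc t + j)) * Q ^ (A - t) = Q ^ (Suc A + j) * Q ^ (t * (t + Suc j))"
          by (simp only: power_add[symmetric])
        thus ?thesis
          by (simp add: w_def del: power_Suc mult_Suc)
      qed (simp add: qbinom_eq_0)
    qed
    finally show ?thesis by simp
  qed
  have R_rec: "R (Suc A) j (Suc k) = Q ^ (Suc A + B) * R (Suc A) j k + R A j (Suc k)
      + Q ^ (Suc A + j) * R A (Suc j) k" for A j k
  proof -
    have 1: "gbin (int (Suc A + Suc k + j)) (int (Suc k)) = gbin (int (A + Suc k + j)) (int (Suc k))
        + Q ^ (Suc A + j) * gbin (int (A + Suc k + j)) (int k)"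
    proof -
      have "nat (int (Suc A + Suc k + j) - int (Suc k)) = Suc A + j" by simp
      thus ?thesis
        using pascal[of "int (Suc A + Suc k + j)" "int (Suc k)"] by (simp add: algebra_simps)
    qed
    have 2: "Q ^ (Suc A + j) * gbin (int (B + Suc k)) (int (Suc k + j))
        = Q ^ (Suc A + j) * gbin (int (B + k)) (int (k + Suc j)) + Q ^ (Suc A + B) * gbin (int (B + k)) (int (k + j))"
    proof (cases "j \<le> B")
      case True
      have e: "nat (int (B + Suc k) - int (Suc k + j)) = B - j" by linarith
      have "Q ^ (Suc A + j) * Q ^ (B - j) = Q ^ (Suc A + B)"
        using True by (simp flip: power_add)
      thus ?thesis
        using pascal[of "int (B + Suc k)" "int (Suc k + j)"] unfolding e
        by (simp add: distrib_left algebra_simps) (metis (no_types, opaque_lifting) mult.assoc mult.commute)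
    qed (simp add: qbinom_eq_0)
    have "R (Suc A) j (Suc k) = R A j (Suc k)
       + gbin (int (A + Suc k + j)) (int k) * (Q ^ (Suc A + j) * gbin (int (B + Suc k)) (int (Suc k + j)))"
      unfolding R_def 1 by (simp add: algebra_simps)
    thus ?thesis
      unfolding 2 R_def by (simp add: algebra_simps)
  qed
  have "S A j k = R A j k"
  proof (induction A arbitrary: j k)
    case 0
    \<comment> \<open>Only \<open>t = 0\<close> survives, and the claim becomes the revision of a
      product of two binomials.\<close>
    have "S 0 j k = (\<Sum>t\<le>k. if t = 0 then gbin (int B) (int j) * gbin (int (B + k)) (int k) else 0)"
      unfolding S_def by (intro sum.cong refl) (auto simp: qbinom_eq_0 qbinom_0_right norm_Q)
    also have "\<dots> = gbin (int B) (int j) * gbin (int (B + k)) (int k)"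
      by simp
    also have "\<dots> = R 0 j k"
    proof (cases "j \<le> B")
      case True
      have 1: "gbin (int B) (int j) = qpoch Q Q B / (qpoch Q Q j * qpoch Q Q (B - j))"
        using True by (rule qbinom_nat)
      have 2: "gbin (int (B + k)) (int k) = qpoch Q Q (B + k) / (qpoch Q Q k * qpoch Q Q B)"
        by (subst qbinom_nat) auto
      have 3: "gbin (int (0 + k + j)) (int k) = qpoch Q Q (k + j) / (qpoch Q Q k * qpoch Q Q j)"
        by (subst qbinom_nat) auto
      have 4: "gbin (int (B + k)) (int (k + j)) = qpoch Q Q (B + k) / (qpoch Q Q (k + j) * qpoch Q Q (B - j))"
        using True by (subst qbinom_nat) auto
      show ?thesis
        unfolding R_def 1 2 3 4 using qpoch_self_nonzero[OF norm_Q] by (simp add: field_simps)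
    qed (simp add: R_def qbinom_eq_0)
    finally show ?case .
  next
    case (Suc A)
    note IH = this
    show ?case
    proof (induction k)
      case 0
      show ?case by (simp add: S_def R_def qbinom_0_right norm_Q)
    next
      case (Suc k)
      show ?case unfolding S_rec R_rec Suc IH ..
    qed
  qed
  thus ?thesis
    unfolding S_def R_def .
qed

text \<open>\<open>q_saalschuetz\<close> with both upper indices equal to \<open>M\<close> and K =
  2k, after reflection of binomials. It merges the two coefficients of orders M + j and M - j
  occurring in \<open>trinom L M j j\<close> into coefficients of order 2M, the order in
  \<open>cubic_sum\<close>.\<close>

lemma ebinom_mult:
  "ebinom (int M + int j) K * ebinom (int M - int j) (K + 2 * int j)
   = (\<Sum>t\<le>M. Q ^ (t * (t + j)) * gbin (int M) (int t) * gbin (int M) (int (t + j)) * ebinom (2 * int M) (K - 2 * int t))"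
proof (cases "even K \<and> K \<ge> 0")
  case False
  thus ?thesis
    by (subst sum.neutral) (auto simp: ebinom_def qbinom_eq_0)
next
  case True
  then obtain k where K: "K = 2 * int k"
    by (metis evenE zero_le_imp_eq_int zero_le_mult_iff zero_less_numeral le_less not_less)
  have 1: "ebinom (int M + int j) K = gbin (int (M + k + j)) (int k)"
    using qbinom_sym[of "int (M + k + j)" "int k" Q] by (simp add: ebinom_def K algebra_simps)
  have "(K + 2 * int j) div 2 = int k + int j" by (simp add: K)
  hence 2: "ebinom (int M - int j) (K + 2 * int j) = gbin (int (M + k)) (int (k + j))"
    using qbinom_sym[of "int (M + k)" "int (k + j)" Q] by (simp add: ebinom_def K algebra_simps)
  have 3: "gbin (int (M + M + k) - int t) (int k - int t) = ebinom (2 * int M) (K - 2 * int t)" for t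
  proof -
    have "(K - 2 * int t) div 2 = int k - int t" by (simp add: K)
    thus ?thesis
      using qbinom_sym[of "int (M + M + k) - int t" "int k - int t" Q]
      by (simp add: ebinom_def K algebra_simps)
  qed
  define h where "h t = Q ^ (t * (t + j)) * gbin (int M) (int t) * gbin (int M) (int (t + j)) * ebinom (2 * int M) (K - 2 * int t)" for t
  have "gbin (int (M + k + j)) (int k) * gbin (int (M + k)) (int (k + j)) = (\<Sum>t\<le>k. h t)"
    unfolding q_saalschuetz[symmetric] 3 h_def ..
  \<comment> \<open>The range changes from \<open>k\<close> to \<open>M\<close> through a common
    larger one: terms beyond \<open>k\<close> vanish by \<open>ebinom\<close>, terms beyond
    \<open>M\<close> by \<open>gbin\<close>.\<close>
  also have "\<dots> = (\<Sum>t\<le>k + M. h t)"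
    by (rule sum.mono_neutral_left) (auto simp: h_def ebinom_eq_0 K)
  also have "\<dots> = (\<Sum>t\<le>M. h t)"
    by (rule sum.mono_neutral_right) (auto simp: h_def qbinom_eq_0)
  finally show ?thesis
    unfolding 1 2 h_def .
qed

section \<open>The sum over \<open>m\<close>\<close>

definition theta_coeff :: "int \<Rightarrow> complex" where
  "theta_coeff j = s ^ nat (3 * j\<^sup>2 + 2 * j)"

text \<open>Here \<open>M\<close> stands for n_\<nu> and \<open>L\<close> for i - N_1 - ... -
  N_\<nu>. The second Gaussian binomial of the summand is an \<open>ebinom\<close>, which also
  enforces the parity condition by vanishing for odd \<open>L - int m\<close>.\<close>

definition cubic_sum :: "int \<Rightarrow> nat \<Rightarrow> complex" where
  "cubic_sum L M = (\<Sum>m\<le>3 * M. s ^ m\<^sup>2 * qbinom (3 * int M) (int m) (s ^ 2) * ebinom (2 * int M) (L - int m))"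

text \<open>The odd exponents 1, 3, ..., 6M - 1 of \<open>s\<close> are sorted by their residue
  modulo 6.\<close>

lemma cubic_prod:
  "(\<Prod>i<3 * M. [:1, s * (s ^ 2) ^ i:])
     = (\<Prod>i<M. [:1, s * Q ^ i:]) * (\<Prod>i<M. [:1, s ^ 5 * Q ^ i:]) * (\<Prod>i<M. [:1, s ^ 3 * Q ^ i:])"
proof (induction M)
  case (Suc M)
  have e: "3 * Suc M = Suc (Suc (Suc (3 * M)))" by simp
  have e0: "s * (s ^ 2) ^ k = s ^ (2 * k + 1)" for k
    by (simp add: power_mult)
  have e1: "s * Q ^ M = s ^ (6 * M + 1)" "s ^ k * Q ^ M = s ^ (6 * M + k)" for k
    by (simp_all add: power_mult[symmetric] power_add mult.commute)
  have f: "s * (s ^ 2) ^ (3 * M) = s * Q ^ M" "s * (s ^ 2) ^ Suc (3 * M) = s ^ 3 * Q ^ M"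
    "s * (s ^ 2) ^ Suc (Suc (3 * M)) = s ^ 5 * Q ^ M"
    unfolding e0 e1 by (rule arg_cong[where f = "\<lambda>n. s ^ n"], simp)+
  show ?case
    unfolding e prod.lessThan_Suc f Suc by (simp only: mult_ac)
qed simp

text \<open>Compares the coefficients of the two factorizations in \<open>cubic_prod\<close>. The
  factors with s and s^5 carry the linear exponents -2t and 2u, from which the theta exponent will
  arise; the factor with s^3 is the numerator in the generating function of
  \<open>trinom\<close>.\<close>

lemma cubic_sum_eq_triple:
  "cubic_sum L M = (\<Sum>t\<le>M. \<Sum>u\<le>M. \<Sum>n\<le>M. s ^ (3 * t\<^sup>2 - 2 * t) * gbin (int M) (int t)
     * (s ^ (3 * u\<^sup>2 + 2 * u) * gbin (int M) (int u)) * (s ^ (3 * n\<^sup>2) * gbin (int M) (int n))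
     * ebinom (2 * int M) (L - int (t + u + n)))"
proof -
  define P where "P v = (\<Prod>i<M. [:1, v * Q ^ i:])" for v
  have cP: "coeff (P v) m = v ^ m * Q ^ (m * (m - 1) div 2) * gbin (int M) (int m)" for v m
    unfolding P_def by (rule coeff_qbinom_theorem[OF norm_Q])
  have dP: "degree (P v) \<le> M" for v
    by (rule degree_le) (auto simp: cP qbinom_eq_0)
  have t: "6 * (m * (m - 1) div 2) + 3 * m = 3 * m\<^sup>2" for m :: nat
    using triangle_exp[of m] by linarith
  have c1: "coeff (P s) m = s ^ (3 * m\<^sup>2 - 2 * m) * gbin (int M) (int m)" for m
  proof -
    have e: "m + 6 * (m * (m - 1) div 2) = 3 * m\<^sup>2 - 2 * m"
      using t[of m] by linarith
    show ?thesis unfolding cP power_mult[symmetric] power_add[symmetric] e ..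
  qed
  have c2: "coeff (P (s ^ 5)) m = s ^ (3 * m\<^sup>2 + 2 * m) * gbin (int M) (int m)" for m
  proof -
    have e: "5 * m + 6 * (m * (m - 1) div 2) = 3 * m\<^sup>2 + 2 * m"
      using t[of m] by linarith
    show ?thesis unfolding cP power_mult[symmetric] power_add[symmetric] e ..
  qed
  have c3: "coeff (P (s ^ 3)) m = s ^ (3 * m\<^sup>2) * gbin (int M) (int m)" for m
  proof -
    have e: "3 * m + 6 * (m * (m - 1) div 2) = 3 * m\<^sup>2"
      using t[of m] by linarith
    show ?thesis unfolding cP power_mult[symmetric] power_add[symmetric] e ..
  qed
  have "norm (s ^ 2) < 1"
    using norm_power_less_one[OF norm_s, of 2] by simp
  hence c4: "coeff (P s * P (s ^ 5) * P (s ^ 3)) m = s ^ m\<^sup>2 * qbinom (3 * int M) (int m) (s ^ 2)" for m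
  proof -
    have e: "m + 2 * (m * (m - 1) div 2) = m\<^sup>2"
      using triangle_exp[of m] by linarith
    show ?thesis
      unfolding P_def cubic_prod[symmetric] coeff_qbinom_theorem[OF \<open>norm (s ^ 2) < 1\<close>]
      unfolding power_mult[symmetric] power_add[symmetric] e by simp
  qed
  define \<phi> where "\<phi> m = ebinom (2 * int M) (L - int m)" for m
  have "cubic_sum L M = (\<Sum>m\<le>M + M + M. coeff (P s * P (s ^ 5) * P (s ^ 3)) m * \<phi> m)"
    unfolding cubic_sum_def c4 \<phi>_def by (rule sum.cong) auto
  also have "\<dots> = (\<Sum>m\<le>M + M. \<Sum>n\<le>M. coeff (P s * P (s ^ 5)) m * coeff (P (s ^ 3)) n * \<phi> (m + n))"
    by (intro sum_coeff_mult dP order.trans[OF degree_mult_le] add_mono)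
  also have "\<dots> = (\<Sum>m\<le>M + M. coeff (P s * P (s ^ 5)) m * (\<Sum>n\<le>M. coeff (P (s ^ 3)) n * \<phi> (m + n)))"
    by (simp only: sum_distrib_left mult.assoc)
  also have "\<dots> = (\<Sum>t\<le>M. \<Sum>u\<le>M. coeff (P s) t * coeff (P (s ^ 5)) u * (\<Sum>n\<le>M. coeff (P (s ^ 3)) n * \<phi> (t + u + n)))"
    by (intro sum_coeff_mult dP)
  finally show ?thesis
    unfolding c1 c2 c3 \<phi>_def by (simp only: sum_distrib_left mult.assoc)
qed

text \<open>For u = t + j, 3t^2 - 2t + 3u^2 + 2u = 3j^2 + 2j + 6t(t + j): the part free of
  \<open>t\<close> is \<open>theta_coeff j\<close>, the rest is the weight in
  \<open>ebinom_mult\<close>. Negative \<open>j\<close> corresponds to exchanging \<open>t\<close>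
  and \<open>u\<close>, and \<open>trinom\<close> is invariant under a joint change of sign.\<close>

lemma cubic_sum_eq_T:
  "cubic_sum L M = (\<Sum>j\<in>{- int M..int M}. theta_coeff j * trinom L M j j)"
proof -
  define H where "H t u = (\<Sum>n\<le>M. s ^ (3 * t\<^sup>2 - 2 * t) * gbin (int M) (int t)
     * (s ^ (3 * u\<^sup>2 + 2 * u) * gbin (int M) (int u)) * (s ^ (3 * n\<^sup>2) * gbin (int M) (int n))
     * ebinom (2 * int M) (L - int (t + u + n)))" for t u
  have H0: "H t u = 0" if "t > M \<or> u > M" for t u
    using that by (auto simp: H_def qbinom_eq_0)
  have trinom: "trinom L M (int j) (int j) = (\<Sum>t\<le>M. \<Sum>n\<le>M. s ^ (3 * n\<^sup>2) * gbin (int M) (int n)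
      * (Q ^ (t * (t + j)) * gbin (int M) (int t) * gbin (int M) (int (t + j))
      * ebinom (2 * int M) (L - int j - int n - 2 * int t)))" for j
  proof -
    have "trinom L M (int j) (int j) = (\<Sum>n\<le>M. s ^ (3 * n\<^sup>2) * gbin (int M) (int n)
      * (ebinom (int M + int j) (L - int j - int n) * ebinom (int M - int j) (L - int j - int n + 2 * int j)))"
      by (simp add: trinom_def trinom_gen_def algebra_simps)
    thus ?thesis
      unfolding ebinom_mult sum_distrib_left by (subst sum.swap)
  qed
  have pos: "theta_coeff (int j) * trinom L M (int j) (int j) = (\<Sum>t\<le>M. H t (t + j))"
    and neg: "theta_coeff (- int j) * trinom L M (int j) (int j) = (\<Sum>t\<le>M. H (t + j) t)" for j
  proof -
    have e: "s ^ nat (3 * (int j)\<^sup>2 + 2 * int j) * Q ^ (t * (t + j))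
        = s ^ (3 * t\<^sup>2 - 2 * t) * s ^ (3 * (t + j)\<^sup>2 + 2 * (t + j))"
      "s ^ nat (3 * (int j)\<^sup>2 - 2 * int j) * Q ^ (t * (t + j))
        = s ^ (3 * (t + j)\<^sup>2 - 2 * (t + j)) * s ^ (3 * t\<^sup>2 + 2 * t)" for t
    proof -
      have le: "2 * x \<le> 3 * x\<^sup>2" for x :: nat
        by (cases x) (auto simp: power2_eq_square)
      have n1: "nat (3 * (int j)\<^sup>2 + 2 * int j) = 3 * j\<^sup>2 + 2 * j"
        by (simp flip: of_nat_power of_nat_add of_nat_mult add: nat_add_distrib nat_mult_distrib)
      have n2: "nat (3 * (int j)\<^sup>2 - 2 * int j) = 3 * j\<^sup>2 - 2 * j"
      proof -
        have "int (3 * j\<^sup>2 - 2 * j) = 3 * (int j)\<^sup>2 - 2 * int j"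
          using le[of j] by (simp add: of_nat_diff)
        thus ?thesis by (metis nat_int)
      qed
      have a1: "3 * j\<^sup>2 + 2 * j + 6 * (t * (t + j)) = 3 * t\<^sup>2 - 2 * t + (3 * (t + j)\<^sup>2 + 2 * (t + j))"
      proof -
        obtain d where d: "3 * t\<^sup>2 = 2 * t + d"
          using le[of t] le_Suc_ex by blast
        have "3 * j\<^sup>2 + 2 * j + 6 * (t * (t + j)) = d + (3 * (t + j)\<^sup>2 + 2 * (t + j))"
          using d by (simp add: power2_eq_square algebra_simps)
        thus ?thesis by (simp add: d)
      qed
      have a2: "3 * j\<^sup>2 - 2 * j + 6 * (t * (t + j)) = 3 * (t + j)\<^sup>2 - 2 * (t + j) + (3 * t\<^sup>2 + 2 * t)"
      proof -
        obtain d where d: "3 * j\<^sup>2 = 2 * j + d"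
          using le[of j] le_Suc_ex by blast
        obtain d' where d': "3 * (t + j)\<^sup>2 = 2 * (t + j) + d'"
          using le[of "t + j"] le_Suc_ex by blast
        have "d + 6 * (t * (t + j)) = d' + (3 * t\<^sup>2 + 2 * t)"
          using d d' by (simp add: power2_eq_square algebra_simps)
        thus ?thesis by (simp add: d d')
      qed
      show "s ^ nat (3 * (int j)\<^sup>2 + 2 * int j) * Q ^ (t * (t + j))
        = s ^ (3 * t\<^sup>2 - 2 * t) * s ^ (3 * (t + j)\<^sup>2 + 2 * (t + j))"
        unfolding n1 power_mult[symmetric] power_add[symmetric] a1 ..
      show "s ^ nat (3 * (int j)\<^sup>2 - 2 * int j) * Q ^ (t * (t + j))
        = s ^ (3 * (t + j)\<^sup>2 - 2 * (t + j)) * s ^ (3 * t\<^sup>2 + 2 * t)"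
        unfolding n2 power_mult[symmetric] power_add[symmetric] a2 ..
    qed
    have comb: "x * (x1 * x2 * (z * x3 * x4 * x5)) = y * x3 * (y' * x4) * (x1 * x2) * x5"
      "x * (x1 * x2 * (z * x3 * x4 * x5)) = y * x4 * (y' * x3) * (x1 * x2) * x5"
      if "x * z = y * y'" for x x1 x2 x3 x4 x5 y y' z :: complex
      using that by algebra+
    have i: "L - int j - int n - 2 * int t = L - int (t + (t + j) + n)" 
      "L - int j - int n - 2 * int t = L - int (t + j + t + n)" for n t
      by simp_all
    show "theta_coeff (int j) * trinom L M (int j) (int j) = (\<Sum>t\<le>M. H t (t + j))"
      unfolding trinom sum_distrib_left H_def theta_coeff_def
    proof (intro sum.cong refl)
      fix t n
      show "s ^ nat (3 * (int j)\<^sup>2 + 2 * int j) * (s ^ (3 * n\<^sup>2) * gbin (int M) (int n)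
        * (Q ^ (t * (t + j)) * gbin (int M) (int t) * gbin (int M) (int (t + j))
        * ebinom (2 * int M) (L - int j - int n - 2 * int t)))
        = s ^ (3 * t\<^sup>2 - 2 * t) * gbin (int M) (int t)
        * (s ^ (3 * (t + j)\<^sup>2 + 2 * (t + j)) * gbin (int M) (int (t + j))) * (s ^ (3 * n\<^sup>2) * gbin (int M) (int n))
        * ebinom (2 * int M) (L - int (t + (t + j) + n))"
        unfolding i(1) by (rule comb(1)[OF e(1)])
    qed
    show "theta_coeff (- int j) * trinom L M (int j) (int j) = (\<Sum>t\<le>M. H (t + j) t)"
      unfolding trinom sum_distrib_left H_def theta_coeff_def
    proof (intro sum.cong refl)
      fix t n
      have "s ^ nat (3 * (int j)\<^sup>2 - 2 * int j) * (s ^ (3 * n\<^sup>2) * gbin (int M) (int n)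
        * (Q ^ (t * (t + j)) * gbin (int M) (int t) * gbin (int M) (int (t + j))
        * ebinom (2 * int M) (L - int j - int n - 2 * int t)))
        = s ^ (3 * (t + j)\<^sup>2 - 2 * (t + j)) * gbin (int M) (int (t + j))
        * (s ^ (3 * t\<^sup>2 + 2 * t) * gbin (int M) (int t)) * (s ^ (3 * n\<^sup>2) * gbin (int M) (int n))
        * ebinom (2 * int M) (L - int (t + j + t + n))"
        unfolding i(2) by (rule comb(2)[OF e(2)])
      thus "s ^ nat (3 * (- int j)\<^sup>2 + 2 * (- int j)) * (s ^ (3 * n\<^sup>2) * gbin (int M) (int n)
        * (Q ^ (t * (t + j)) * gbin (int M) (int t) * gbin (int M) (int (t + j))
        * ebinom (2 * int M) (L - int j - int n - 2 * int t)))
        = s ^ (3 * (t + j)\<^sup>2 - 2 * (t + j)) * gbin (int M) (int (t + j))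
        * (s ^ (3 * t\<^sup>2 + 2 * t) * gbin (int M) (int t)) * (s ^ (3 * n\<^sup>2) * gbin (int M) (int n))
        * ebinom (2 * int M) (L - int (t + j + t + n))"
        by simp
    qed
  qed
  define D where "D j = {x \<in> {..M} \<times> {..M}. int (snd x) - int (fst x) = j}" for j
  have fib: "(\<Sum>(t, u)\<in>D j. H t u) = theta_coeff j * trinom L M j j" for j
  proof (cases "j \<ge> 0")
    case True
    then obtain k where j: "j = int k"
      using zero_le_imp_eq_int by blast
    have "(\<Sum>t\<le>M. H t (t + k)) = (\<Sum>t\<in>{t. t + k \<le> M}. H t (t + k))"
      by (rule sum.mono_neutral_right) (auto simp: H0)
    also have "\<dots> = (\<Sum>(t, u)\<in>D j. H t u)"
      by (rule sum.reindex_bij_witness[of _ fst "\<lambda>t. (t, t + k)"]) (auto simp: D_def j)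
    finally show ?thesis
      using pos[of k] by (simp add: j)
  next
    case False
    then obtain k where j: "j = - int k"
      by (metis int_cases2 of_nat_0_le_iff)
    have "(\<Sum>t\<le>M. H (t + k) t) = (\<Sum>t\<in>{t. t + k \<le> M}. H (t + k) t)"
      by (rule sum.mono_neutral_right) (auto simp: H0)
    also have "\<dots> = (\<Sum>(t, u)\<in>D j. H t u)"
      by (rule sum.reindex_bij_witness[of _ snd "\<lambda>t. (t + k, t)"]) (auto simp: D_def j)
    finally show ?thesis
      using neg[of k] trinom_minus[of L M "int k" "int k"] by (simp add: j)
  qed
  have "cubic_sum L M = (\<Sum>(t, u)\<in>{..M} \<times> {..M}. H t u)"
    unfolding cubic_sum_eq_triple H_def[symmetric] by (simp add: sum.cartesian_product)
  also have "\<dots> = (\<Sum>j\<in>{- int M..int M}. \<Sum>(t, u)\<in>D j. H t u)"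
    unfolding D_def by (rule sum.group[symmetric]) auto
  finally show ?thesis
    unfolding fib .
qed

section \<open>Iterating the transformation\<close>

lemma burge_minus: "burge (- a) (- b) L M = burge a b L M"
  by (simp add: burge_def trinom_minus)

text \<open>Multiples of \<bar>j\<bar> satisfy the restriction in \<open>trinom_transform\<close>;
  negative \<open>j\<close> follows by the joint change of sign.\<close>

lemma trinom_transform_multiple:
  "burge ((int k + 1) * j) j L M = s ^ (3 * (nat \<bar>j\<bar>)\<^sup>2) * trinom L M ((int k + 2) * j) j"
proof -
  define b where "b = nat \<bar>j\<bar>"
  have main: "burge ((int k + 1) * int b) (int b) L M = s ^ (3 * b\<^sup>2) * trinom L M ((int k + 2) * int b) (int b)"
    using trinom_transform[of b "(int k + 1) * int b" L M] by (simp add: algebra_simps)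
  show ?thesis
  proof (cases "j \<ge> 0")
    case True
    hence "j = int b" by (simp add: b_def)
    thus ?thesis using main by simp
  next
    case False
    hence j: "j = - int b" by (simp add: b_def)
    show ?thesis
      using main burge_minus[of "(int k + 1) * int b" "int b" L M] trinom_minus[of L M "(int k + 2) * int b" "int b"]
      unfolding j by simp
  qed
qed

text \<open>\<open>M\<close> is the partial sum N of one level and \<open>r\<close> that of the
  next, so the Gaussian binomial is the one with lower index n = M - r, reflected. In this form the
  kernel is that of \<open>burge\<close>.\<close>

primrec burge_iter :: "nat \<Rightarrow> int \<Rightarrow> nat \<Rightarrow> complex" where
  "burge_iter 0 L M = cubic_sum L M"
| "burge_iter (Suc k) L M = (\<Sum>r\<le>M. s ^ (3 * r\<^sup>2) * gbin (L + int M - int r) L * burge_iter k (L - int r) r)"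

text \<open>Each transformation multiplies the j-th term by s^(3j^2) and adds \<open>j\<close> to
  the first parameter. The range of \<open>j\<close> can stay fixed under the sum over
  \<open>r\<close> because \<open>trinom\<close> vanishes for \<bar>j\<bar> > r.\<close>

lemma burge_iter_eq:
  "burge_iter k L M = (\<Sum>j\<in>{- int M..int M}. theta_coeff j * s ^ (3 * k * (nat \<bar>j\<bar>)\<^sup>2) * trinom L M ((int k + 1) * j) j)"
proof (induction k arbitrary: L M)
  case 0
  show ?case by (simp add: cubic_sum_eq_T)
next
  case (Suc k)
  define c where "c j = theta_coeff j * s ^ (3 * k * (nat \<bar>j\<bar>)\<^sup>2)" for j
  have "burge_iter (Suc k) L M = (\<Sum>r\<le>M. \<Sum>j\<in>{- int M..int M}. c j
      * (s ^ (3 * r\<^sup>2) * gbin (L + int M - int r) L * trinom (L - int r) r ((int k + 1) * j) j))"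
    unfolding burge_iter.simps
  proof (intro sum.cong refl)
    fix r assume "r \<in> {..M}"
    hence "burge_iter k (L - int r) r = (\<Sum>j\<in>{- int M..int M}. c j * trinom (L - int r) r ((int k + 1) * j) j)"
      unfolding Suc.IH c_def by (intro sum.mono_neutral_left) (auto simp: trinom_eq_0)
    thus "s ^ (3 * r\<^sup>2) * gbin (L + int M - int r) L * burge_iter k (L - int r) r = (\<Sum>j\<in>{- int M..int M}. c j
      * (s ^ (3 * r\<^sup>2) * gbin (L + int M - int r) L * trinom (L - int r) r ((int k + 1) * j) j))"
      by (simp add: sum_distrib_left mult_ac)
  qed
  also have "\<dots> = (\<Sum>j\<in>{- int M..int M}. c j * burge ((int k + 1) * j) j L M)"
    unfolding burge_def sum_distrib_left by (rule sum.swap)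
  also have "\<dots> = (\<Sum>j\<in>{- int M..int M}. theta_coeff j * s ^ (3 * Suc k * (nat \<bar>j\<bar>)\<^sup>2)
      * trinom L M ((int (Suc k) + 1) * j) j)"
  proof (intro sum.cong refl)
    fix j
    have "c j * s ^ (3 * (nat \<bar>j\<bar>)\<^sup>2) = theta_coeff j * s ^ (3 * Suc k * (nat \<bar>j\<bar>)\<^sup>2)"
      by (simp add: c_def distrib_right power_add)
    moreover have "int (Suc k) + 1 = int k + 2" by simp
    ultimately show "c j * burge ((int k + 1) * j) j L M
        = theta_coeff j * s ^ (3 * Suc k * (nat \<bar>j\<bar>)\<^sup>2) * trinom L M ((int (Suc k) + 1) * j) j"
      unfolding trinom_transform_multiple by (simp only: mult.assoc[symmetric])
  qed
  finally show ?case .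
qed

section \<open>The limit of infinite order\<close>

text \<open>The coefficient of z^K in 1/(z^2;Q)_inf. A shift of the order disappears in the limit,
  which is why \<open>trinom_lim\<close> has no parameter \<open>b\<close>.\<close>

definition ebinom_lim :: "int \<Rightarrow> complex" where
  "ebinom_lim K = (if even K \<and> K \<ge> 0 then 1 / qpoch Q Q (nat (K div 2)) else 0)"

definition trinom_lim :: "nat \<Rightarrow> int \<Rightarrow> complex" where
  "trinom_lim l c = (\<Sum>n\<le>l. s ^ (3 * n\<^sup>2) / qpoch Q Q n * ebinom_lim (int l - c - int n) * ebinom_lim (int l + c - int n))"

lemma ebinom_lim_eq_0: "K < 0 \<Longrightarrow> ebinom_lim K = 0"
  by (simp add: ebinom_lim_def)

lemma trinom_lim_minus: "trinom_lim l (- c) = trinom_lim l c"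
  by (simp add: trinom_lim_def mult_ac)

lemma trinom_lim_eq_0: "int l < \<bar>c\<bar> \<Longrightarrow> trinom_lim l c = 0"
  unfolding trinom_lim_def
  by (rule sum.neutral) (smt (verit) ebinom_lim_eq_0 mult_eq_0_iff of_nat_0_le_iff)

lemma ebinom_tendsto: "(\<lambda>M. ebinom (int M + b) K) \<longlonglongrightarrow> ebinom_lim K"
proof (cases "even K \<and> K \<ge> 0")
  case True
  then obtain k' where "K = 2 * k'" "k' \<ge> 0"
    by (elim conjE evenE) auto
  then obtain k where K: "K = 2 * int k"
    using zero_le_imp_eq_int by blast
  have "ebinom (int M + b) K = gbin (int M + (b + int k)) (int k)" for M
    using qbinom_sym[of "int M + (b + int k)" "int k" Q] by (simp add: ebinom_def K algebra_simps)
  thus ?thesis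
    using qbinom_tendsto[OF norm_Q, of "b + int k" k] by (simp add: ebinom_lim_def K)
next
  case False
  hence "ebinom (int M + b) K = 0" for M
    by (auto simp: ebinom_def qbinom_eq_0)
  thus ?thesis
    using False by (auto simp: ebinom_lim_def)
qed

lemma trinom_tendsto: "(\<lambda>M. trinom (int l) M c b) \<longlonglongrightarrow> trinom_lim l c"
proof -
  have "(\<lambda>M. \<Sum>n\<le>l. s ^ (3 * n\<^sup>2) * gbin (int M) (int n) * ebinom (int M + b) (int l - c - int n)
      * ebinom (int M + - b) (int l + c - int n)) \<longlonglongrightarrow> (\<Sum>n\<le>l. s ^ (3 * n\<^sup>2) * (1 / qpoch Q Q n)
      * ebinom_lim (int l - c - int n) * ebinom_lim (int l + c - int n))"
    by (intro tendsto_intros ebinom_tendsto qbinom_tendsto_nat norm_Q)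
  moreover have "eventually (\<lambda>M. (\<Sum>n\<le>l. s ^ (3 * n\<^sup>2) * gbin (int M) (int n) * ebinom (int M + b) (int l - c - int n)
      * ebinom (int M + - b) (int l + c - int n)) = trinom (int l) M c b) sequentially"
  proof (rule eventually_sequentiallyI[of l])
    fix M assume "l \<le> M"
    \<comment> \<open>The two arguments add up to 2(l - n), so for \<open>n > l\<close> one of them
      is negative; the sum is cut at \<open>l\<close>, independently of \<open>M\<close>.\<close>
    have z: "ebinom A (int l - c - int n) * ebinom B (int l + c - int n) = 0" if "n > l" for A B n
    proof (cases "int l - c - int n < 0")
      case False
      hence "int l + c - int n < 0" using that by linarith
      thus ?thesis by (simp add: ebinom_eq_0)
    qed (simp add: ebinom_eq_0)
    show "(\<Sum>n\<le>l. s ^ (3 * n\<^sup>2) * gbin (int M) (int n) * ebinom (int M + b) (int l - c - int n)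
      * ebinom (int M + - b) (int l + c - int n)) = trinom (int l) M c b"
      unfolding trinom_def trinom_gen_def mult.assoc using \<open>l \<le> M\<close>
      by (intro sum.mono_neutral_cong_left) (auto simp: z)
  qed
  ultimately show ?thesis
    unfolding trinom_lim_def using Lim_transform_eventually by fastforce
qed

lemma burge_tendsto:
  "(\<lambda>M. burge a b (int l) M) \<longlonglongrightarrow> (\<Sum>r\<le>l. s ^ (3 * r\<^sup>2) * trinom (int l - int r) r a b) / qpoch Q Q l"
proof -
  have "(\<lambda>M. \<Sum>r\<le>l. s ^ (3 * r\<^sup>2) * gbin (int M + (int l - int r)) (int l) * trinom (int l - int r) r a b)
      \<longlonglongrightarrow> (\<Sum>r\<le>l. s ^ (3 * r\<^sup>2) * (1 / qpoch Q Q l) * trinom (int l - int r) r a b)"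
    by (intro tendsto_intros qbinom_tendsto norm_Q)
  moreover have "eventually (\<lambda>M. (\<Sum>r\<le>l. s ^ (3 * r\<^sup>2) * gbin (int M + (int l - int r)) (int l)
      * trinom (int l - int r) r a b) = burge a b (int l) M) sequentially"
  proof (rule eventually_sequentiallyI[of l])
    fix M assume "l \<le> M"
    moreover have z: "trinom (int l - int r) r a b = 0" if "\<not> r \<le> l" for r
      by (rule trinom_eq_0) (use that in linarith)
    ultimately show "(\<Sum>r\<le>l. s ^ (3 * r\<^sup>2) * gbin (int M + (int l - int r)) (int l) * trinom (int l - int r) r a b) = burge a b (int l) M"
      unfolding burge_def by (intro sum.mono_neutral_cong_left) (auto simp: z algebra_simps)
  qed
  ultimately have "(\<lambda>M. burge a b (int l) M) \<longlonglongrightarrow> (\<Sum>r\<le>l. s ^ (3 * r\<^sup>2) * (1 / qpoch Q Q l) * trinom (int l - int r) r a b)"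
    by (rule Lim_transform_eventually)
  thus ?thesis
    by (simp add: sum_divide_distrib)
qed

text \<open>Both sides are limits of the same \<open>burge\<close> sums as \<open>M\<close> tends to
  infinity. On the left the Gaussian binomials have become 1/(Q;Q)_l, the factor 1/(q^3;q^3)_i of
  the theorem.\<close>

lemma trinom_transform_limit:
  "(\<Sum>r\<le>l. s ^ (3 * r\<^sup>2) * trinom (int l - int r) r ((int k + 1) * j) j) / qpoch Q Q l
     = s ^ (3 * (nat \<bar>j\<bar>)\<^sup>2) * trinom_lim l ((int k + 2) * j)"
proof (rule LIMSEQ_unique)
  show "(\<lambda>M. burge ((int k + 1) * j) j (int l) M) \<longlonglongrightarrow> s ^ (3 * (nat \<bar>j\<bar>)\<^sup>2) * trinom_lim l ((int k + 2) * j)"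
    unfolding trinom_transform_multiple by (intro tendsto_intros trinom_tendsto)
qed (rule burge_tendsto)

lemma burge_iter_limit:
  "(\<Sum>r\<le>l. s ^ (3 * r\<^sup>2) * burge_iter k (int l - int r) r) / qpoch Q Q l
     = (\<Sum>j\<in>{- int l..int l}. theta_coeff j * s ^ (3 * Suc k * (nat \<bar>j\<bar>)\<^sup>2) * trinom_lim l ((int k + 2) * j))"
proof -
  define c where "c j = theta_coeff j * s ^ (3 * k * (nat \<bar>j\<bar>)\<^sup>2)" for j
  have "(\<Sum>r\<le>l. s ^ (3 * r\<^sup>2) * burge_iter k (int l - int r) r)
      = (\<Sum>r\<le>l. \<Sum>j\<in>{- int l..int l}. c j * (s ^ (3 * r\<^sup>2) * trinom (int l - int r) r ((int k + 1) * j) j))"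
  proof (intro sum.cong refl)
    fix r assume "r \<in> {..l}"
    hence "burge_iter k (int l - int r) r = (\<Sum>j\<in>{- int l..int l}. c j * trinom (int l - int r) r ((int k + 1) * j) j)"
      unfolding burge_iter_eq c_def by (intro sum.mono_neutral_left) (auto simp: trinom_eq_0)
    thus "s ^ (3 * r\<^sup>2) * burge_iter k (int l - int r) r
      = (\<Sum>j\<in>{- int l..int l}. c j * (s ^ (3 * r\<^sup>2) * trinom (int l - int r) r ((int k + 1) * j) j))"
      by (simp add: sum_distrib_left mult_ac)
  qed
  also have "\<dots> = (\<Sum>j\<in>{- int l..int l}. c j * (\<Sum>r\<le>l. s ^ (3 * r\<^sup>2) * trinom (int l - int r) r ((int k + 1) * j) j))"
    unfolding sum_distrib_left by (rule sum.swap)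
  moreover have distr: "(\<Sum>j\<in>A. c j * X j) / q = (\<Sum>j\<in>A. c j * (X j / q))" for X q and A :: "int set"
    by (simp add: sum_divide_distrib)
  ultimately have "(\<Sum>r\<le>l. s ^ (3 * r\<^sup>2) * burge_iter k (int l - int r) r) / qpoch Q Q l
      = (\<Sum>j\<in>{- int l..int l}. c j * (s ^ (3 * (nat \<bar>j\<bar>)\<^sup>2) * trinom_lim l ((int k + 2) * j)))"
    unfolding trinom_transform_limit[symmetric] by (simp only: distr)
  also have "\<dots> = (\<Sum>j\<in>{- int l..int l}. theta_coeff j * s ^ (3 * Suc k * (nat \<bar>j\<bar>)\<^sup>2) * trinom_lim l ((int k + 2) * j))"
  proof (intro sum.cong refl)
    fix j
    have "c j * s ^ (3 * (nat \<bar>j\<bar>)\<^sup>2) = theta_coeff j * s ^ (3 * Suc k * (nat \<bar>j\<bar>)\<^sup>2)"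
      by (simp add: c_def distrib_right power_add)
    thus "c j * (s ^ (3 * (nat \<bar>j\<bar>)\<^sup>2) * trinom_lim l ((int k + 2) * j))
        = theta_coeff j * s ^ (3 * Suc k * (nat \<bar>j\<bar>)\<^sup>2) * trinom_lim l ((int k + 2) * j)"
      by (simp only: mult.assoc[symmetric])
  qed
  finally show ?thesis .
qed

section \<open>Summation over \<open>l\<close> and the theta series\<close>

lemma trinom_lim_bounded:
  obtains K where "K \<ge> 0" "\<And>l c. norm (trinom_lim l c) \<le> real (Suc l) * K"
proof -
  obtain K where K: "K \<ge> 1" "\<And>n. norm (1 / qpoch Q Q n) \<le> K"
    using inverse_qpoch_bounded[OF norm_Q] by blast
  have e: "norm (ebinom_lim x) \<le> K" for x
    using K by (auto simp: ebinom_lim_def)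
  have "norm (trinom_lim l c) \<le> real (Suc l) * (1 * K * K * K)" for l c
  proof -
    have "norm (trinom_lim l c) \<le> (\<Sum>n\<le>l. 1 * K * K * K)"
      unfolding trinom_lim_def
    proof (rule sum_norm_le)
      fix n assume "n \<in> {..l}"
      have "norm (s ^ (3 * n\<^sup>2) / qpoch Q Q n * ebinom_lim (int l - c - int n) * ebinom_lim (int l + c - int n))
        = norm (s ^ (3 * n\<^sup>2)) * norm (1 / qpoch Q Q n) * norm (ebinom_lim (int l - c - int n)) * norm (ebinom_lim (int l + c - int n))"
        by (simp add: norm_mult norm_divide)
      also have "\<dots> \<le> 1 * K * K * K"
        using K(1) norm_s by (intro mult_mono e K(2)) (auto simp: norm_power power_le_one)
      finally show "norm (s ^ (3 * n\<^sup>2) / qpoch Q Q n * ebinom_lim (int l - c - int n) * ebinom_lim (int l + c - int n))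
        \<le> 1 * K * K * K" .
    qed
    thus ?thesis by (simp add: algebra_simps)
  qed
  thus ?thesis
    using K(1) by (intro that[of "1 * K * K * K"]) auto
qed

text \<open>With l = n + 2r + c, 3l^2 + 3n^2 = 3c^2 + 6(n + r)(n + r + c) + 6r(r + c). For fixed m =
  n + r the sum over \<open>r\<close> is \<open>qvandermonde_sum\<close>, and the remaining sum over
  m is Cauchy's identity.\<close>

lemma trinom_lim_has_sum_nat:
  "((\<lambda>l. s ^ (3 * l\<^sup>2) * trinom_lim l (int c)) has_sum s ^ (3 * c\<^sup>2) / qpoch_inf Q Q) UNIV"
proof -
  define w where "w n r = s ^ (3 * c\<^sup>2) * Q ^ ((n + r) * (n + r + c)) * Q ^ (r * (r + c))
      / (qpoch Q Q n * qpoch Q Q r * qpoch Q Q (r + c))" for n r :: nat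
  obtain K where K: "K \<ge> 1" "\<And>n. norm (1 / qpoch Q Q n) \<le> K"
    using inverse_qpoch_bounded[OF norm_Q] by blast
  have bound: "norm (w n r) \<le> (K * K * K) * norm (Q ^ n * Q ^ r)" for n r
  proof -
    have "n + r \<le> (n + r) * (n + r + c)"
      by (cases "n + r") auto
    hence 1: "norm (Q ^ ((n + r) * (n + r + c))) \<le> norm (Q ^ (n + r))"
      using norm_Q by (intro norm_power_le_power) auto
    have "norm (w n r) = norm (s ^ (3 * c\<^sup>2)) * norm (Q ^ ((n + r) * (n + r + c))) * norm (Q ^ (r * (r + c)))
       * (norm (1 / qpoch Q Q n) * norm (1 / qpoch Q Q r) * norm (1 / qpoch Q Q (r + c)))"
      by (simp add: w_def norm_mult norm_divide)
    also have "\<dots> \<le> 1 * norm (Q ^ (n + r)) * 1 * (K * K * K)"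
      using K(1) norm_s norm_Q by (intro mult_mono 1 K(2)) (auto simp: norm_power power_le_one)
    finally show ?thesis
      by (simp add: power_add mult_ac)
  qed
  have "(\<lambda>(n, r). norm (Q ^ n * Q ^ r)) summable_on UNIV \<times> UNIV"
    by (intro abs_summable_on_times geometric_summable_on norm_Q)
  hence "(\<lambda>x. (K * K * K) * (case x of (n, r) \<Rightarrow> norm (Q ^ n * Q ^ r))) summable_on UNIV \<times> UNIV"
    by (rule summable_on_cmult_right)
  hence "(\<lambda>x. norm (case x of (n, r) \<Rightarrow> w n r)) summable_on UNIV \<times> UNIV"
    by (rule Infinite_Sum.abs_summable_on_comparison_test') (use bound in auto)
  hence w: "(\<lambda>(n, r). w n r) summable_on UNIV \<times> UNIV"
    by (rule abs_summable_summable)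
  have re1: "((\<lambda>(n, r). w n r) has_sum S) (UNIV \<times> UNIV)
      = ((\<lambda>(m, r). w (m - r) r) has_sum S) (SIGMA m:UNIV. {..m})" for S
    by (rule has_sum_reindex_bij_witness[of _ "\<lambda>(m, r). (m - r, r)" "\<lambda>(n, r). (n + r, r)"]) auto
  have "((\<lambda>(m, r). w (m - r) r) has_sum s ^ (3 * c\<^sup>2) * (1 / qpoch_inf Q Q)) (SIGMA m:UNIV. {..m})"
  proof (rule has_sum_SigmaI)
    show "((\<lambda>m. s ^ (3 * c\<^sup>2) * (Q ^ (m * (m + c)) / (qpoch Q Q m * qpoch Q Q (m + c)))) has_sum
      s ^ (3 * c\<^sup>2) * (1 / qpoch_inf Q Q)) UNIV"
      by (intro has_sum_cmult_right cauchy_has_sum norm_Q)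
    show "(\<lambda>(m, r). w (m - r) r) summable_on (SIGMA m:UNIV. {..m})"
      using w re1 unfolding summable_on_def by blast
    fix m
    have "s ^ (3 * c\<^sup>2) * (Q ^ (m * (m + c)) / (qpoch Q Q m * qpoch Q Q (m + c)))
       = s ^ (3 * c\<^sup>2) * Q ^ (m * (m + c)) / qpoch Q Q m * (1 / qpoch Q Q (m + c))"
      by simp
    also have "\<dots> = (\<Sum>r\<le>m. w (m - r) r)"
      unfolding qvandermonde_sum[OF norm_Q, symmetric] sum_distrib_left
    proof (intro sum.cong refl)
      fix r assume "r \<in> {..m}"
      thus "s ^ (3 * c\<^sup>2) * Q ^ (m * (m + c)) / qpoch Q Q m * (Q ^ (r * (r + c)) * gbin (int m) (int r) / qpoch Q Q (r + c))
        = w (m - r) r"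
        using qpoch_self_nonzero[OF norm_Q] by (simp add: w_def qbinom_nat mult_ac)
    qed
    finally show "((\<lambda>r. case (m, r) of (m, r) \<Rightarrow> w (m - r) r) has_sum
        s ^ (3 * c\<^sup>2) * (Q ^ (m * (m + c)) / (qpoch Q Q m * qpoch Q Q (m + c)))) {..m}"
      by simp
  qed
  hence W: "((\<lambda>(n, r). w n r) has_sum s ^ (3 * c\<^sup>2) / qpoch_inf Q Q) (UNIV \<times> UNIV)"
    using re1 by simp
  \<comment> \<open>\<open>D l\<close> consists of those \<open>n\<close> for which r = (l - c -
    n)/2 is a natural number; for every other \<open>n \<le> l\<close> the first
    \<open>ebinom_lim\<close> is zero.\<close>
  define D where "D l = {n. n + c \<le> l \<and> even (l - c - n)}" for l
  define t where "t l n = s ^ (3 * l\<^sup>2) * (s ^ (3 * n\<^sup>2) / qpoch Q Q n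
      * ebinom_lim (int l - int c - int n) * ebinom_lim (int l + int c - int n))" for l n
  have t: "t (n + 2 * r + c) n = w n r" for n r
  proof -
    have "3 * (n + 2 * r + c)\<^sup>2 + 3 * n\<^sup>2 = 3 * c\<^sup>2 + 6 * ((n + r) * (n + r + c)) + 6 * (r * (r + c))"
      by (simp add: power2_eq_square algebra_simps)
    hence e: "s ^ (3 * (n + 2 * r + c)\<^sup>2) * s ^ (3 * n\<^sup>2)
        = s ^ (3 * c\<^sup>2) * Q ^ ((n + r) * (n + r + c)) * Q ^ (r * (r + c))"
      by (simp only: power_mult[symmetric] power_add[symmetric])
    have "nat ((2 * int r + 2 * int c) div 2) = r + c" by simp
    hence "ebinom_lim (2 * int r + 2 * int c) = 1 / qpoch Q Q (r + c)"
      by (simp add: ebinom_lim_def)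
    hence 2: "ebinom_lim (int (n + 2 * r + c) + int c - int n) = 1 / qpoch Q Q (r + c)"
      by (simp add: algebra_simps)
    have 1: "ebinom_lim (int (n + 2 * r + c) - int c - int n) = 1 / qpoch Q Q r"
      by (simp add: ebinom_lim_def)
    have "t (n + 2 * r + c) n = (s ^ (3 * (n + 2 * r + c)\<^sup>2) * s ^ (3 * n\<^sup>2))
        / (qpoch Q Q n * qpoch Q Q r * qpoch Q Q (r + c))"
      unfolding t_def 1 2 by simp
    thus ?thesis
      unfolding e w_def .
  qed
  have "((\<lambda>(n, r). w n r) has_sum s ^ (3 * c\<^sup>2) / qpoch_inf Q Q) (UNIV \<times> UNIV)
      = ((\<lambda>(l, n). t l n) has_sum s ^ (3 * c\<^sup>2) / qpoch_inf Q Q) (SIGMA l:UNIV. D l)"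
  proof (rule has_sum_reindex_bij_witness[of _ "\<lambda>(l, n). (n, (l - c - n) div 2)" "\<lambda>(n, r). (n + 2 * r + c, n)"])
    fix x assume "x \<in> (SIGMA l:UNIV. D l)"
    then obtain l n where x: "x = (l, n)" and le: "n + c \<le> l" and ev: "even (l - c - n)"
      by (auto simp: D_def)
    have "n + 2 * ((l - c - n) div 2) + c = l"
      unfolding dvd_mult_div_cancel[OF ev] using le by simp
    thus "(case (case x of (l, n) \<Rightarrow> (n, (l - c - n) div 2)) of (n, r) \<Rightarrow> (n + 2 * r + c, n)) = x"
      by (simp add: x)
  qed (auto simp: D_def t)
  hence "((\<lambda>(l, n). t l n) has_sum s ^ (3 * c\<^sup>2) / qpoch_inf Q Q) (SIGMA l:UNIV. D l)"
    using W by blast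
  thus ?thesis
  proof (rule has_sum_Sigma')
    fix l
    have "D l \<subseteq> {..l}"
      by (auto simp: D_def)
    moreover have "t l n = 0" if "n \<in> {..l} - D l" for n
    proof -
      have "ebinom_lim (int l - int c - int n) = 0"
      proof (cases "n + c \<le> l")
        case True
        hence "int l - int c - int n = int (l - c - n)" by simp
        moreover have "odd (int (l - c - n))"
          unfolding even_of_nat using that True by (simp add: D_def)
        ultimately have "odd (int l - int c - int n)" by (simp only:) simp
        thus ?thesis unfolding ebinom_lim_def by (simp only: simp_thms if_False)
      qed (simp add: ebinom_lim_def)
      thus ?thesis by (simp add: t_def)
    qed
    ultimately have "sum (t l) (D l) = (\<Sum>n\<le>l. t l n)"
      by (intro sum.mono_neutral_left) auto
    also have "\<dots> = s ^ (3 * l\<^sup>2) * trinom_lim l (int c)"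
      by (simp add: t_def trinom_lim_def sum_distrib_left)
    finally show "((\<lambda>n. case (l, n) of (l, n) \<Rightarrow> t l n) has_sum s ^ (3 * l\<^sup>2) * trinom_lim l (int c)) (D l)"
      using finite_subset[OF \<open>D l \<subseteq> {..l}\<close>] by (intro has_sum_finiteI) auto
  qed
qed

lemma trinom_lim_has_sum:
  "((\<lambda>l. s ^ (3 * l\<^sup>2) * trinom_lim l c) has_sum s ^ (3 * (nat \<bar>c\<bar>)\<^sup>2) / qpoch_inf Q Q) UNIV"
proof (cases "c \<ge> 0")
  case True
  thus ?thesis using trinom_lim_has_sum_nat[of "nat \<bar>c\<bar>"] by simp
next
  case False
  thus ?thesis using trinom_lim_has_sum_nat[of "nat \<bar>c\<bar>"] trinom_lim_minus[of _ c] by simp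
qed

lemma norm_theta_coeff_le: "norm (theta_coeff j) \<le> norm (s ^ nat \<bar>j\<bar>)"
proof -
  have "\<bar>j\<bar> \<le> j\<^sup>2"
    by (metis abs_ge_zero abs_of_nonneg int_one_le_iff_zero_less linorder_not_less mult_le_cancel_left1 order.order_iff_strict power2_abs power2_eq_square zero_less_abs_iff)
  hence "nat \<bar>j\<bar> \<le> nat (3 * j\<^sup>2 + 2 * j)"
    by linarith
  thus ?thesis
    unfolding theta_coeff_def using norm_s by (intro norm_power_le_power) auto
qed

definition theta :: "nat \<Rightarrow> complex" where
  "theta C = qpoch_inf (s ^ (12 * C)) (s ^ (12 * C)) * qpoch_inf (- (s ^ (6 * C + 2))) (s ^ (12 * C))
     * qpoch_inf (- (s ^ (6 * C - 2))) (s ^ (12 * C))"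

text \<open>For \<open>u\<close> and \<open>v\<close> with exponents 6C + 2 and 6C - 2, the
  triangular powers in the triple product combine to the exponent 6Cj^2 + 2j. The hypothesis on
  \<open>C\<close> is the one for \<nu> = k + 1.\<close>

lemma theta_has_sum:
  assumes C: "2 * C = (k + 3) * (k + 2)"
  shows "((\<lambda>j. theta_coeff j * s ^ (3 * Suc k * (nat \<bar>j\<bar>)\<^sup>2) * s ^ (3 * (nat \<bar>(int k + 2) * j\<bar>)\<^sup>2))
    has_sum theta C) UNIV"
proof -
  have C1: "C > 0" using C by (cases C) auto
  define u where "u = s ^ (6 * C + 2)"
  define v where "v = s ^ (6 * C - 2)"
  have u: "norm u < 1" and v: "norm v < 1"
    unfolding u_def v_def using C1 norm_s by (intro norm_power_less_one; simp)+
  have "6 * C + 2 + (6 * C - 2) = 12 * C"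
    using C1 by simp
  hence uv: "u * v = s ^ (12 * C)"
    by (simp only: u_def v_def power_add[symmetric])
  have eq: "u ^ nat (j * (j + 1) div 2) * v ^ nat (j * (j - 1) div 2)
      = theta_coeff j * s ^ (3 * Suc k * (nat \<bar>j\<bar>)\<^sup>2) * s ^ (3 * (nat \<bar>(int k + 2) * j\<bar>)\<^sup>2)" for j
  proof -
    define p where "p = nat (j * (j + 1) div 2)"
    define m where "m = nat (j * (j - 1) div 2)"
    have nn: "j * (j + 1) \<ge> 0" "j * (j - 1) \<ge> 0"
      by (simp_all add: zero_le_mult_iff) linarith+
    have p: "2 * int p = j * j + j" and m: "2 * int m = j * j - j"
      using nn by (auto simp: p_def m_def algebra_simps)
    have "3 * j\<^sup>2 + 2 * j \<ge> 0"
    proof -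
      have "3 * j\<^sup>2 + 2 * j = 2 * (j * (j + 1)) + j\<^sup>2"
        by (simp add: power2_eq_square algebra_simps)
      thus ?thesis using nn zero_le_power2[of j] by linarith
    qed
    hence th: "int (nat (3 * j\<^sup>2 + 2 * j)) = 3 * j\<^sup>2 + 2 * j" by simp
    have v': "int (6 * C - 2) = 6 * int C - 2" using C1 by simp
    have C': "2 * int C = (int k + 3) * (int k + 2)"
      using arg_cong[OF C, of int] by (simp add: algebra_simps)
    have "int ((6 * C + 2) * p + (6 * C - 2) * m) = (3 * int C + 1) * (2 * int p) + (3 * int C - 1) * (2 * int m)"
      unfolding of_nat_add of_nat_mult v' by (simp add: algebra_simps)
    also have "\<dots> = 3 * (2 * int C) * j\<^sup>2 + 2 * j"
      unfolding p m by (simp add: power2_eq_square algebra_simps)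
    also have "\<dots> = 3 * j\<^sup>2 + 2 * j + 3 * (int k + 1) * \<bar>j\<bar>\<^sup>2 + 3 * \<bar>(int k + 2) * j\<bar>\<^sup>2"
      unfolding C' by (simp add: power2_eq_square algebra_simps)
    also have "\<dots> = int (nat (3 * j\<^sup>2 + 2 * j) + 3 * Suc k * (nat \<bar>j\<bar>)\<^sup>2 + 3 * (nat \<bar>(int k + 2) * j\<bar>)\<^sup>2)"
      unfolding of_nat_add of_nat_mult of_nat_power th by (simp add: algebra_simps)
    finally have e: "(6 * C + 2) * p + (6 * C - 2) * m
       = nat (3 * j\<^sup>2 + 2 * j) + 3 * Suc k * (nat \<bar>j\<bar>)\<^sup>2 + 3 * (nat \<bar>(int k + 2) * j\<bar>)\<^sup>2"
      by (rule of_nat_eq_iff[THEN iffD1])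
    show ?thesis
      unfolding u_def v_def theta_coeff_def p_def[symmetric] m_def[symmetric]
      unfolding power_mult[symmetric] power_add[symmetric] e ..
  qed
  show ?thesis
    using jacobi_triple_product[OF u v] unfolding eq uv theta_def by (simp only: u_def v_def)
qed

text \<open>Up to a constant \<open>h l j\<close> is dominated by (l + 1) \<bar>s\<bar>^l
  \<bar>s\<bar>^\<bar>j\<bar>, so the double sum may be taken in either order. Summing over
  \<open>l\<close> first gives the theta series; summing over \<open>j\<close> first gives
  \<open>burge_iter_limit\<close>, a finite sum since \<open>trinom_lim\<close> vanishes for
  \<bar>j\<bar> > l.\<close>

lemma main_has_sum:
  assumes C: "2 * C = (k + 3) * (k + 2)"
  shows "((\<lambda>l. s ^ (3 * l\<^sup>2) / qpoch Q Q l * (\<Sum>r\<le>l. s ^ (3 * r\<^sup>2) * burge_iter k (int l - int r) r))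
    has_sum theta C / qpoch_inf Q Q) UNIV"
proof -
  define c where "c j = theta_coeff j * s ^ (3 * Suc k * (nat \<bar>j\<bar>)\<^sup>2)" for j
  define h where "h l j = c j * (s ^ (3 * l\<^sup>2) * trinom_lim l ((int k + 2) * j))" for l j
  obtain K where K: "K \<ge> 0" "\<And>l c. norm (trinom_lim l c) \<le> real (Suc l) * K"
    using trinom_lim_bounded by blast
  have bound: "norm (h l j) \<le> K * norm (s ^ nat \<bar>j\<bar> * (of_nat (Suc l) * s ^ l))" for l j
  proof -
    have 1: "norm (c j) \<le> norm (s ^ nat \<bar>j\<bar>) * 1"
      unfolding c_def norm_mult using norm_s
      by (intro mult_mono norm_theta_coeff_le) (auto simp: norm_power power_le_one)
    have "l \<le> 3 * l\<^sup>2"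
      by (cases l) (auto simp: power2_eq_square)
    hence 2: "norm (s ^ (3 * l\<^sup>2)) \<le> norm (s ^ l)"
      using norm_s by (intro norm_power_le_power) auto
    have "norm (h l j) = norm (c j) * (norm (s ^ (3 * l\<^sup>2)) * norm (trinom_lim l ((int k + 2) * j)))"
      by (simp add: h_def norm_mult)
    also have "\<dots> \<le> norm (s ^ nat \<bar>j\<bar>) * 1 * (norm (s ^ l) * (real (Suc l) * K))"
      using K(1) by (intro mult_mono 1 2 K(2)) auto
    finally show ?thesis
      by (simp add: norm_mult mult_ac del: of_nat_Suc)
  qed
  have "(\<lambda>l. norm (of_nat (Suc l) * s ^ l)) summable_on UNIV"
  proof -
    have "summable (\<lambda>l. real (Suc l) * norm s ^ l)"
      using geometric_deriv_sums[of "norm s"] norm_s by (auto simp: sums_iff)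
    thus ?thesis
      by (subst summable_on_UNIV_nonneg_real_iff) (auto simp: norm_mult norm_power simp del: of_nat_Suc)
  qed
  hence "(\<lambda>(j, l). norm (s ^ nat \<bar>j\<bar> * (of_nat (Suc l) * s ^ l))) summable_on UNIV \<times> UNIV"
    by (intro abs_summable_on_times geometric_int_summable_on norm_s)
  hence "(\<lambda>x. K * (case x of (j, l) \<Rightarrow> norm (s ^ nat \<bar>j\<bar> * (of_nat (Suc l) * s ^ l)))) summable_on UNIV \<times> UNIV"
    by (rule summable_on_cmult_right)
  hence "(\<lambda>x. norm (case x of (j, l) \<Rightarrow> h l j)) summable_on UNIV \<times> UNIV"
    by (rule Infinite_Sum.abs_summable_on_comparison_test') (use bound in auto)
  hence sm: "(\<lambda>(j, l). h l j) summable_on UNIV \<times> UNIV"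
    by (rule abs_summable_summable)
  have "((\<lambda>(j, l). h l j) has_sum theta C / qpoch_inf Q Q) (UNIV \<times> UNIV)"
  proof (rule has_sum_SigmaI[OF _ _ sm])
    show "((\<lambda>l. case (j, l) of (j, l) \<Rightarrow> h l j) has_sum
        c j * (s ^ (3 * (nat \<bar>(int k + 2) * j\<bar>)\<^sup>2) / qpoch_inf Q Q)) UNIV" for j
      unfolding prod.case h_def by (intro has_sum_cmult_right trinom_lim_has_sum)
    show "((\<lambda>j. c j * (s ^ (3 * (nat \<bar>(int k + 2) * j\<bar>)\<^sup>2) / qpoch_inf Q Q)) has_sum theta C / qpoch_inf Q Q) UNIV"
      using has_sum_cmult_left[OF theta_has_sum[OF C], of "1 / qpoch_inf Q Q"] by (simp add: c_def)
  qed
  hence "((\<lambda>(l, j). h l j) has_sum theta C / qpoch_inf Q Q) (UNIV \<times> UNIV)"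
    by (subst has_sum_swap) simp
  thus ?thesis
  proof (rule has_sum_Sigma')
    fix l :: nat
    have "((\<lambda>j. h l j) has_sum (\<Sum>j\<in>{- int l..int l}. h l j)) {- int l..int l}"
      by (rule has_sum_finite) simp
    also have "?this \<longleftrightarrow> ((\<lambda>j. h l j) has_sum (\<Sum>j\<in>{- int l..int l}. h l j)) UNIV"
    proof (rule has_sum_cong_neutral)
      fix j assume "j \<in> UNIV - {- int l..int l}"
      hence "\<bar>j\<bar> > int l" by auto
      moreover have "\<bar>(int k + 2) * j\<bar> \<ge> \<bar>j\<bar>"
        by (simp add: abs_mult mult_le_cancel_right1)
      ultimately show "h l j = 0"
        by (simp add: h_def trinom_lim_eq_0)
    qed auto
    also have "(\<Sum>j\<in>{- int l..int l}. h l j)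
        = s ^ (3 * l\<^sup>2) / qpoch Q Q l * (\<Sum>r\<le>l. s ^ (3 * r\<^sup>2) * burge_iter k (int l - int r) r)"
    proof -
      have "s ^ (3 * l\<^sup>2) / qpoch Q Q l * (\<Sum>r\<le>l. s ^ (3 * r\<^sup>2) * burge_iter k (int l - int r) r)
          = s ^ (3 * l\<^sup>2) * ((\<Sum>r\<le>l. s ^ (3 * r\<^sup>2) * burge_iter k (int l - int r) r) / qpoch Q Q l)"
        by simp
      also have "\<dots> = (\<Sum>j\<in>{- int l..int l}. h l j)"
        unfolding burge_iter_limit sum_distrib_left h_def c_def by (intro sum.cong refl) (simp only: mult_ac)
      finally show ?thesis ..
    qed
    finally show "((\<lambda>j. case (l, j) of (l, j) \<Rightarrow> h l j) has_sum
        s ^ (3 * l\<^sup>2) / qpoch Q Q l * (\<Sum>r\<le>l. s ^ (3 * r\<^sup>2) * burge_iter k (int l - int r) r)) UNIV"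
      by simp
  qed
qed

section \<open>The multisum\<close>

text \<open>The multisum over \<open>n\<^sub>1, \<dots>, n\<^sub>\<nu>\<close> as a recursion: \<open>n + sum_list ns\<close> is the partial sum
  \<open>N\<close> belonging to the head \<open>n\<close>, and each step lowers \<open>L\<close> by \<open>N\<close>.\<close>

primrec chain :: "(int \<Rightarrow> nat \<Rightarrow> complex) \<Rightarrow> nat list \<Rightarrow> int \<Rightarrow> complex" where
  "chain f [] L = 0"
| "chain f (n # ns) L = (let N = n + sum_list ns in s ^ (3 * N\<^sup>2) *
     (if ns = [] then f (L - int N) n else gbin (L - int N + int n) (int n) * chain f ns (L - int N)))"

text \<open>Unrolling the recursion recovers the shape of \<open>summand\<close>: the last index
  contributes the value of \<open>f\<close> instead of a Gaussian binomial, so the product stops at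
  \<nu> - 1.\<close>

lemma chain_map:
  fixes n N :: "nat \<Rightarrow> nat"
  assumes "k \<le> \<nu>"
  defines "N \<equiv> tail_sum \<nu> n"
  shows "chain f (map n [k..<Suc \<nu>]) L = s ^ (3 * (\<Sum>i=k..\<nu>. (N i)\<^sup>2))
    * (\<Prod>j\<in>{k..<\<nu>}. gbin (L - (\<Sum>i=k..j. int (N i)) + int (n j)) (int (n j)))
    * f (L - (\<Sum>i=k..\<nu>. int (N i))) (n \<nu>)"
  using assms(1)
proof (induction "\<nu> - k" arbitrary: k L)
  case 0
  hence k: "k = \<nu>" by simp
  show ?case
    by (simp add: k N_def tail_sum_def Let_def)
next
  case (Suc d)
  hence k: "k < \<nu>" by simp
  have l: "[k..<Suc \<nu>] = k # [Suc k..<Suc \<nu>]"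
    using k by (simp add: upt_conv_Cons)
  have Nk: "n k + sum_list (map n [Suc k..<Suc \<nu>]) = N k"
    unfolding interv_sum_list_conv_sum_set_nat set_upt N_def tail_sum_def
    using k by (simp add: sum.atLeast_Suc_atMost atLeastLessThanSuc_atLeastAtMost)
  have ne: "map n [Suc k..<Suc \<nu>] \<noteq> []"
    using k by simp
  have IH: "chain f (map n [Suc k..<Suc \<nu>]) (L - int (N k)) = s ^ (3 * (\<Sum>i=Suc k..\<nu>. (N i)\<^sup>2))
    * (\<Prod>j\<in>{Suc k..<\<nu>}. gbin (L - int (N k) - (\<Sum>i=Suc k..j. int (N i)) + int (n j)) (int (n j)))
    * f (L - int (N k) - (\<Sum>i=Suc k..\<nu>. int (N i))) (n \<nu>)"
    using Suc.hyps(1)[of "Suc k" "L - int (N k)"] Suc.hyps(2) k by simp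
  have S: "L - int (N k) - (\<Sum>i=Suc k..j. int (N i)) = L - (\<Sum>i=k..j. int (N i))" if "k \<le> j" for j
    using that by (simp add: sum.atLeast_Suc_atMost)
  have P: "(\<Prod>j\<in>{Suc k..<\<nu>}. gbin (L - int (N k) - (\<Sum>i=Suc k..j. int (N i)) + int (n j)) (int (n j)))
      = (\<Prod>j\<in>{Suc k..<\<nu>}. gbin (L - (\<Sum>i=k..j. int (N i)) + int (n j)) (int (n j)))"
    by (intro prod.cong refl, subst S) auto
  have "chain f (map n [k..<Suc \<nu>]) L = s ^ (3 * (N k)\<^sup>2) * (gbin (L - int (N k) + int (n k)) (int (n k))
      * chain f (map n [Suc k..<Suc \<nu>]) (L - int (N k)))"
    unfolding l list.map chain.simps Nk Let_def using ne by simp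
  also have "\<dots> = s ^ (3 * (N k)\<^sup>2 + 3 * (\<Sum>i=Suc k..\<nu>. (N i)\<^sup>2))
      * (gbin (L - int (N k) + int (n k)) (int (n k))
       * (\<Prod>j\<in>{Suc k..<\<nu>}. gbin (L - (\<Sum>i=k..j. int (N i)) + int (n j)) (int (n j))))
      * f (L - (\<Sum>i=k..\<nu>. int (N i))) (n \<nu>)"
    unfolding IH P S[OF less_imp_le[OF k]] power_add by (simp only: mult_ac)
  also have "3 * (N k)\<^sup>2 + 3 * (\<Sum>i=Suc k..\<nu>. (N i)\<^sup>2) = 3 * (\<Sum>i=k..\<nu>. (N i)\<^sup>2)"
    using k by (simp add: sum.atLeast_Suc_atMost)
  also have "gbin (L - int (N k) + int (n k)) (int (n k))
       * (\<Prod>j\<in>{Suc k..<\<nu>}. gbin (L - (\<Sum>i=k..j. int (N i)) + int (n j)) (int (n j)))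
     = (\<Prod>j\<in>{k..<\<nu>}. gbin (L - (\<Sum>i=k..j. int (N i)) + int (n j)) (int (n j)))"
    using k by (simp add: prod.atLeast_Suc_lessThan)
  finally show ?case .
qed

text \<open>The first step already lowers \<open>L\<close> by \<open>sum_list ns\<close> and no
  later step raises it, so \<open>f\<close> is evaluated below \<open>m\<close>. This leaves
  finitely many nonzero terms for each \<open>i\<close>.\<close>

lemma chain_eq_0:
  assumes "\<And>L' M. L' < int m \<Longrightarrow> f L' M = 0"
  shows "L < int (sum_list ns + m) \<Longrightarrow> chain f ns L = 0"
  by (induction ns arbitrary: L) (auto simp: assms Let_def)

lemma chain_sum: "chain (\<lambda>L M. \<Sum>m\<in>X. f m L M) ns L = (\<Sum>m\<in>X. chain (f m) ns L)"
  by (induction ns arbitrary: L) (auto simp: Let_def sum_distrib_left)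

lemma chain_cong:
  assumes "\<And>L' M. L' \<le> L0 \<Longrightarrow> f L' M = f' L' M"
  shows "L \<le> L0 \<Longrightarrow> chain f ns L = chain f' ns L"
  by (induction ns arbitrary: L) (auto simp: assms Let_def)

text \<open>If the tail of a list with sum \<open>r\<close> has sum r', the head is r - r';
  reflecting its Gaussian binomial gives the kernel of \<open>burge_iter\<close>.\<close>

lemma sum_chain:
  "(\<Sum>ns | length ns = Suc k \<and> sum_list ns = r. chain cubic_sum ns L)
     = s ^ (3 * r\<^sup>2) * burge_iter k (L - int r) r"
proof (induction k arbitrary: r L)
  case 0
  have "{ns :: nat list. length ns = Suc 0 \<and> sum_list ns = r} = {[r]}"
    by (auto simp: length_Suc_conv)
  thus ?case by simp
next
  case (Suc k)
  define X where "X r' = {ns :: nat list. length ns = Suc k \<and> sum_list ns = r'}" for r'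
  have fin: "finite (X r')" for r'
    by (rule finite_subset[OF _ finite_lists_sum[of "Suc k" r']]) (auto simp: X_def)
  have "(\<Sum>ns | length ns = Suc (Suc k) \<and> sum_list ns = r. chain cubic_sum ns L)
      = (\<Sum>(r', ns)\<in>(SIGMA r':{..r}. X r'). chain cubic_sum ((r - r') # ns) L)"
    by (rule sum.reindex_bij_witness[of _ "\<lambda>(r', ns). (r - r') # ns" "\<lambda>ns. (sum_list (tl ns), tl ns)"])
      (auto simp: X_def length_Suc_conv)
  also have "\<dots> = (\<Sum>r'\<le>r. \<Sum>ns\<in>X r'. chain cubic_sum ((r - r') # ns) L)"
    by (rule sum.Sigma[symmetric]) (auto simp: fin)
  also have "\<dots> = (\<Sum>r'\<le>r. s ^ (3 * r\<^sup>2) * (s ^ (3 * r'\<^sup>2) * gbin (L - int r + int r - int r') (L - int r)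
      * burge_iter k (L - int r - int r') r'))"
  proof (intro sum.cong refl)
    fix r' assume "r' \<in> {..r}"
    hence r': "r' \<le> r" by simp
    have "(\<Sum>ns\<in>X r'. chain cubic_sum ((r - r') # ns) L)
       = (\<Sum>ns\<in>X r'. s ^ (3 * r\<^sup>2) * gbin (L - int r + int (r - r')) (int (r - r')) * chain cubic_sum ns (L - int r))"
      using r' by (intro sum.cong refl) (auto simp: X_def Let_def)
    also have "\<dots> = s ^ (3 * r\<^sup>2) * gbin (L - int r + int (r - r')) (int (r - r'))
        * (s ^ (3 * r'\<^sup>2) * burge_iter k (L - int r - int r') r')"
      unfolding sum_distrib_left[symmetric] X_def Suc.IH ..
    also have "gbin (L - int r + int (r - r')) (int (r - r')) = gbin (L - int r + int r - int r') (L - int r)"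
      using qbinom_sym[of "L - int r'" "L - int r" Q] r' by (simp add: of_nat_diff)
    finally show "(\<Sum>ns\<in>X r'. chain cubic_sum ((r - r') # ns) L)
       = s ^ (3 * r\<^sup>2) * (s ^ (3 * r'\<^sup>2) * gbin (L - int r + int r - int r') (L - int r) * burge_iter k (L - int r - int r') r')"
      by (simp only: mult_ac)
  qed
  also have "\<dots> = s ^ (3 * r\<^sup>2) * burge_iter (Suc k) (L - int r) r"
    by (simp add: sum_distrib_left)
  finally show ?case .
qed

section \<open>Summation of the individual terms over \<open>i\<close>, \<open>m\<close> and
  lists\<close>

definition cubic_term :: "nat \<Rightarrow> int \<Rightarrow> nat \<Rightarrow> complex" where
  "cubic_term m L M = s ^ m\<^sup>2 * qbinom (3 * int M) (int m) (s ^ 2) * ebinom (2 * int M) (L - int m)"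

text \<open>The range up to 3M depends on the last entry of the list; the range up to
  \<open>i\<close> makes \<open>m\<close> an independent index. Terms beyond either bound vanish, by
  \<open>ebinom\<close> or by \<open>qbinom\<close>.\<close>

lemma cubic_sum_eq_terms:
  assumes "L \<le> int i"
  shows "(\<Sum>m\<le>i. cubic_term m L M) = cubic_sum L M"
proof -
  have "(\<Sum>m\<le>i. cubic_term m L M) = (\<Sum>m\<le>i + 3 * M. cubic_term m L M)"
    using assms by (intro sum.mono_neutral_left) (auto simp: cubic_term_def ebinom_eq_0)
  also have "\<dots> = (\<Sum>m\<le>3 * M. cubic_term m L M)"
    by (intro sum.mono_neutral_right) (auto simp: cubic_term_def qbinom_eq_0)
  finally show ?thesis
    by (simp add: cubic_sum_def cubic_term_def)
qed

definition list_term :: "nat \<Rightarrow> nat \<Rightarrow> nat list \<Rightarrow> complex" where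
  "list_term i m ns = s ^ (3 * i\<^sup>2) / qpoch Q Q i * chain (cubic_term m) ns (int i)"

lemma list_term_sum:
  "(\<Sum>(m, ns)\<in>{..i} \<times> {ns. length ns = Suc k \<and> sum_list ns \<le> i}. list_term i m ns)
    = s ^ (3 * i\<^sup>2) / qpoch Q Q i * (\<Sum>r\<le>i. s ^ (3 * r\<^sup>2) * burge_iter k (int i - int r) r)"
proof -
  define X where "X = {ns :: nat list. length ns = Suc k \<and> sum_list ns \<le> i}"
  have "(\<Sum>m\<le>i. chain (cubic_term m) ns (int i)) = chain cubic_sum ns (int i)" for ns
    unfolding chain_sum[symmetric] by (rule chain_cong[OF cubic_sum_eq_terms]) auto
  hence "(\<Sum>(m, ns)\<in>{..i} \<times> X. list_term i m ns)
      = s ^ (3 * i\<^sup>2) / qpoch Q Q i * (\<Sum>ns\<in>X. chain cubic_sum ns (int i))"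
    unfolding sum.cartesian_product[symmetric] list_term_def sum_distrib_left[symmetric]
    by (subst sum.swap) simp
  also have "(\<Sum>ns\<in>X. chain cubic_sum ns (int i)) = (\<Sum>r\<le>i. \<Sum>ns\<in>{ns \<in> X. sum_list ns = r}. chain cubic_sum ns (int i))"
    by (rule sum.group[symmetric]) (auto simp: X_def finite_lists_sum)
  also have "\<dots> = (\<Sum>r\<le>i. s ^ (3 * r\<^sup>2) * burge_iter k (int i - int r) r)"
  proof (intro sum.cong refl)
    fix r assume "r \<in> {..i}"
    hence "{ns \<in> X. sum_list ns = r} = {ns. length ns = Suc k \<and> sum_list ns = r}"
      by (auto simp: X_def)
    thus "(\<Sum>ns\<in>{ns \<in> X. sum_list ns = r}. chain cubic_sum ns (int i)) = s ^ (3 * r\<^sup>2) * burge_iter k (int i - int r) r"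
      by (simp only: sum_chain)
  qed
  finally show ?thesis
    unfolding X_def .
qed

lemma list_term_eq_0: "int i < int (sum_list ns + m) \<Longrightarrow> list_term i m ns = 0"
proof -
  have "cubic_term m L M = 0" if "L < int m" for L M
    using that by (simp add: cubic_term_def ebinom_eq_0)
  thus "int i < int (sum_list ns + m) \<Longrightarrow> list_term i m ns = 0"
    using chain_eq_0[of m "cubic_term m" "int i" ns] by (simp add: list_term_def)
qed

text \<open>Quadratic exponents dominate linear ones, and each partial sum N is at least the head
  \<open>n\<close>, so the power s^(3N^2) is bounded by s^n in norm. The Gaussian binomials cost a
  constant that depends on the length only.\<close>

lemma list_term_bounded:
  obtains K where "K \<ge> 0"
    "\<And>i m ns. length ns = k \<Longrightarrow> norm (list_term i m ns) \<le> K * norm (s ^ i * (s ^ m * s ^ sum_list ns))"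
proof -
  have n2: "norm (s ^ 2) < 1"
    using norm_power_less_one[OF norm_s, of 2] by simp
  obtain K1 where K1: "K1 \<ge> 1" "\<And>A B. norm (qbinom A B (s ^ 2)) \<le> K1"
    using qbinom_bounded[OF n2] by blast
  obtain K2 where K2: "K2 \<ge> 1" "\<And>A B. norm (gbin A B) \<le> K2"
    using qbinom_bounded[OF norm_Q] by blast
  obtain K3 where K3: "K3 \<ge> 1" "\<And>n. norm (1 / qpoch Q Q n) \<le> K3"
    using inverse_qpoch_bounded[OF norm_Q] by blast
  have sq: "norm (s ^ (c * n\<^sup>2)) \<le> norm (s ^ n)" if "c \<ge> 1" for c n :: nat
  proof -
    have "n \<le> n * n" by (cases n) auto
    also have "n * n \<le> c * n\<^sup>2"
      using that mult_le_mono1[of 1 c "n * n"] by (simp add: power2_eq_square)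
    finally show ?thesis
      using norm_s by (intro norm_power_le_power) auto
  qed
  have eb: "norm (ebinom A x) \<le> K2" for A x
    using K2 by (auto simp: ebinom_def)
  have ct: "norm (cubic_term m L M) \<le> norm (s ^ m) * (K1 * K2)" for m L M
  proof -
    have "norm (cubic_term m L M) = norm (s ^ m\<^sup>2)
        * (norm (qbinom (3 * int M) (int m) (s ^ 2)) * norm (ebinom (2 * int M) (L - int m)))"
      by (simp add: cubic_term_def norm_mult)
    also have "\<dots> \<le> norm (s ^ m) * (K1 * K2)"
      using K1(1) K2(1) sq[of 1 m] by (intro mult_mono K1(2) eb) auto
    finally show ?thesis .
  qed
  have ch: "norm (chain (cubic_term m) ns L) \<le> norm (s ^ m * s ^ sum_list ns) * (K1 * K2 * K2 ^ length ns)" for m ns L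
  proof (induction ns arbitrary: L)
    case Nil
    show ?case using K1(1) K2(1) by simp
  next
    case (Cons n ns)
    define N where "N = n + sum_list ns"
    show ?case
    proof (cases "ns = []")
      case True
      have "norm (chain (cubic_term m) (n # ns) L) = norm (s ^ (3 * n\<^sup>2)) * norm (cubic_term m (L - int n) n)"
        by (simp add: True norm_mult)
      also have "\<dots> \<le> norm (s ^ n) * (norm (s ^ m) * (K1 * K2))"
        by (intro mult_mono sq ct) auto
      also have "\<dots> \<le> norm (s ^ n) * (norm (s ^ m) * (K1 * K2 * K2))"
        using K1(1) K2(1) mult_left_mono[of 1 K2 "K1 * K2"] by (intro mult_left_mono) auto
      finally show ?thesis
        by (simp add: True norm_mult mult_ac)
    next
      case False
      have "norm (s ^ (3 * N\<^sup>2)) \<le> norm (s ^ N)"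
        by (rule sq) simp
      also have "\<dots> \<le> norm (s ^ n)"
        using norm_s by (intro norm_power_le_power) (auto simp: N_def)
      finally have 1: "norm (s ^ (3 * N\<^sup>2)) \<le> norm (s ^ n)" .
      have "norm (chain (cubic_term m) (n # ns) L) = norm (s ^ (3 * N\<^sup>2))
          * (norm (gbin (L - int N + int n) (int n)) * norm (chain (cubic_term m) ns (L - int N)))"
        using False by (simp add: N_def Let_def norm_mult)
      also have "\<dots> \<le> norm (s ^ n) * (K2 * (norm (s ^ m * s ^ sum_list ns) * (K1 * K2 * K2 ^ length ns)))"
        using K2(1) by (intro mult_mono 1 K2(2) Cons.IH) auto
      finally show ?thesis
        by (simp add: norm_mult power_add mult_ac)
    qed
  qed
  have "norm (list_term i m ns) \<le> K3 * (K1 * K2 * K2 ^ k) * norm (s ^ i * (s ^ m * s ^ sum_list ns))"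
    if "length ns = k" for i m ns
  proof -
    have "norm (list_term i m ns) = norm (s ^ (3 * i\<^sup>2)) * norm (1 / qpoch Q Q i) * norm (chain (cubic_term m) ns (int i))"
      by (simp add: list_term_def norm_mult norm_divide)
    also have "\<dots> \<le> norm (s ^ i) * K3 * (norm (s ^ m * s ^ sum_list ns) * (K1 * K2 * K2 ^ length ns))"
      using K3(1) by (intro mult_mono sq K3(2) ch) auto
    finally show ?thesis
      using that by (simp add: norm_mult mult_ac)
  qed
  moreover have "K3 * (K1 * K2 * K2 ^ k) \<ge> 0"
    using K1(1) K2(1) K3(1) by simp
  ultimately show ?thesis
    by (intro that[of "K3 * (K1 * K2 * K2 ^ k)"])
qed

text \<open>Absolute summability permits grouping by \<open>i\<close>; each group is finite by
  \<open>list_term_eq_0\<close> and is evaluated by \<open>list_term_sum\<close>.\<close>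

lemma list_term_has_sum:
  assumes C: "2 * C = (k + 3) * (k + 2)"
  shows "((\<lambda>(i, m, ns). list_term i m ns) has_sum theta C / qpoch_inf Q Q)
    (UNIV \<times> UNIV \<times> {ns. length ns = Suc k})"
proof -
  define Y where "Y = {ns :: nat list. length ns = Suc k}"
  obtain K where K: "K \<ge> 0"
    "\<And>i m ns. length ns = Suc k \<Longrightarrow> norm (list_term i m ns) \<le> K * norm (s ^ i * (s ^ m * s ^ sum_list ns))"
    using list_term_bounded by blast
  have "(\<lambda>(m, ns). norm (s ^ m * s ^ sum_list ns)) summable_on UNIV \<times> Y"
    unfolding Y_def by (intro abs_summable_on_times geometric_summable_on abs_summable_on_lists norm_s)
  hence "(\<lambda>x. norm (case x of (m, ns) \<Rightarrow> s ^ m * s ^ sum_list ns)) summable_on UNIV \<times> Y"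
    by (simp add: case_prod_unfold)
  hence "(\<lambda>(i, x). norm (s ^ i * (case x of (m, ns) \<Rightarrow> s ^ m * s ^ sum_list ns))) summable_on UNIV \<times> UNIV \<times> Y"
    by (intro abs_summable_on_times geometric_summable_on norm_s)
  hence "(\<lambda>z. K * (case z of (i, x) \<Rightarrow> norm (s ^ i * (case x of (m, ns) \<Rightarrow> s ^ m * s ^ sum_list ns))))
      summable_on UNIV \<times> UNIV \<times> Y"
    by (rule summable_on_cmult_right)
  hence "(\<lambda>z. norm (case z of (i, m, ns) \<Rightarrow> list_term i m ns)) summable_on UNIV \<times> UNIV \<times> Y"
    by (rule Infinite_Sum.abs_summable_on_comparison_test') (use K(2) in \<open>auto simp: Y_def\<close>)
  hence sm: "(\<lambda>(i, m, ns). list_term i m ns) summable_on UNIV \<times> UNIV \<times> Y"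
    by (rule abs_summable_summable)
  have "((\<lambda>(i, m, ns). list_term i m ns) has_sum theta C / qpoch_inf Q Q) (UNIV \<times> UNIV \<times> Y)"
  proof (rule has_sum_SigmaI[OF _ main_has_sum[OF C] sm])
    fix i :: nat
    have z: "m \<le> i \<and> sum_list ns \<le> i" if "list_term i m ns \<noteq> 0" for m ns
      using list_term_eq_0[of i ns m] that by linarith
    define B where "B = {..i} \<times> {ns :: nat list. length ns = Suc k \<and> sum_list ns \<le> i}"
    have "((\<lambda>(m, ns). list_term i m ns) has_sum (\<Sum>(m, ns)\<in>B. list_term i m ns)) B"
      by (rule has_sum_finite) (simp add: B_def finite_lists_sum)
    also have "?this \<longleftrightarrow> ((\<lambda>(m, ns). list_term i m ns) has_sum (\<Sum>(m, ns)\<in>B. list_term i m ns)) (UNIV \<times> Y)"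
      by (rule has_sum_cong_neutral) (auto simp: B_def Y_def dest: z)
    finally show "((\<lambda>x. case (i, x) of (i, m, ns) \<Rightarrow> list_term i m ns) has_sum
        s ^ (3 * i\<^sup>2) / qpoch Q Q i * (\<Sum>r\<le>i. s ^ (3 * r\<^sup>2) * burge_iter k (int i - int r) r)) (UNIV \<times> Y)"
      unfolding B_def list_term_sum by simp
  qed
  thus ?thesis
    unfolding Y_def .
qed

text \<open>If the parity condition fails, \<open>ebinom\<close> has an odd argument and the term is
  zero. If it holds, both halvings are exact, the one in the exponent because squares have the
  parity of their bases.\<close>

lemma list_term_eq_summand:
  fixes n :: "nat \<Rightarrow> nat"
  assumes "\<nu> > 0"
  shows "list_term i m (map n [1..<Suc \<nu>])
    = (if [i + m = (\<Sum>k=1..\<nu>. tail_sum \<nu> n k)] (mod 2) then summand \<nu> (s ^ 2) i m n else 0)"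
proof -
  define N where "N = tail_sum \<nu> n"
  define Z where "Z = (\<Sum>k=1..\<nu>. N k)"
  define Z2 where "Z2 = (\<Sum>k=1..\<nu>. (N k)\<^sup>2)"
  have Z: "(\<Sum>k=1..\<nu>. int (N k)) = int Z"
    by (simp add: Z_def)
  have par: "[i + m = Z] (mod 2) \<longleftrightarrow> even (int i - int Z - int m)"
  proof -
    have "[i + m = Z] (mod 2) \<longleftrightarrow> (even (i + m) \<longleftrightarrow> even Z)"
      by (simp add: cong_def even_iff_mod_2_eq_zero) presburger
    thus ?thesis by auto
  qed
  have parity: "even Z2 \<longleftrightarrow> even Z"
    unfolding Z2_def Z_def by (simp add: even_sum_iff)
  have lt: "list_term i m (map n [1..<Suc \<nu>]) = s ^ (3 * i\<^sup>2) / qpoch Q Q i * (s ^ (3 * Z2)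
    * (\<Prod>j=1..\<nu> - 1. gbin (int i - (\<Sum>i=1..j. int (N i)) + int (n j)) (int (n j)))
    * cubic_term m (int i - int Z) (n \<nu>))"
  proof -
    have "{1..<\<nu>} = {1..\<nu> - 1}"
      using assms by auto
    thus ?thesis
      unfolding list_term_def using chain_map[of 1 \<nu> "cubic_term m" n "int i"] assms
      by (simp only: N_def[symmetric] Z Z2_def[symmetric])
  qed
  show ?thesis
  proof (cases "[i + m = Z] (mod 2)")
    case False
    hence "cubic_term m (int i - int Z) (n \<nu>) = 0"
      using par by (simp add: cubic_term_def ebinom_def)
    thus ?thesis
      using False unfolding lt by (simp add: Z_def N_def)
  next
    case True
    hence ev: "even (int i - int Z - int m)"
      using par by simp
    hence "even (m\<^sup>2 + 3 * (i\<^sup>2 + Z2))"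
      using parity by auto
    hence "2 * ((m\<^sup>2 + 3 * (i\<^sup>2 + Z2)) div 2) = m\<^sup>2 + 3 * i\<^sup>2 + 3 * Z2"
      by simp
    hence "(s ^ 2) ^ ((m\<^sup>2 + 3 * (i\<^sup>2 + Z2)) div 2) = s ^ m\<^sup>2 * s ^ (3 * i\<^sup>2) * s ^ (3 * Z2)"
      by (simp only: power_mult[symmetric] power_add[symmetric])
    moreover have "(s ^ 2) ^ 3 = Q"
      by (simp flip: power_mult)
    moreover have "cubic_term m (int i - int Z) (n \<nu>) = s ^ m\<^sup>2 * qbinom (3 * int (n \<nu>)) (int m) (s ^ 2)
        * gbin (2 * int (n \<nu>) + (int i - int Z - int m) div 2) (2 * int (n \<nu>))"
      using ev by (simp add: cubic_term_def ebinom_def)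
    ultimately have "list_term i m (map n [1..<Suc \<nu>]) = summand \<nu> (s ^ 2) i m n"
      unfolding lt summand_def Let_def N_def[symmetric] Z Z2_def[symmetric] by simp
    thus ?thesis
      using True by (simp add: Z_def N_def)
  qed
qed

text \<open>The index set is enlarged to all triples, terms of wrong parity being zero, and
  extensional tuples are exchanged for lists, the entry with index \<open>j\<close> sitting at
  position \<open>j - 1\<close>.\<close>

lemma summand_has_sum:
  assumes \<nu>: "\<nu> > 0" and C: "2 * C = (\<nu> + 2) * (\<nu> + 1)"
  shows "((\<lambda>(i, m, n). summand \<nu> (s ^ 2) i m n) has_sum theta C / qpoch_inf Q Q) (index_set \<nu>)"
proof -
  obtain k where k: "\<nu> = Suc k"
    using \<nu> gr0_implies_Suc by blast
  define l where "l n = map n [1..<Suc \<nu>]" for n :: "nat \<Rightarrow> nat"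
  define E where "E = {1..\<nu>} \<rightarrow>\<^sub>E (UNIV :: nat set)"
  have "((\<lambda>(i, m, n). summand \<nu> (s ^ 2) i m n) has_sum theta C / qpoch_inf Q Q) (index_set \<nu>)
      \<longleftrightarrow> ((\<lambda>(i, m, n). list_term i m (l n)) has_sum theta C / qpoch_inf Q Q) (UNIV \<times> UNIV \<times> E)"
    by (rule has_sum_cong_neutral)
      (auto simp: index_set_def E_def l_def list_term_eq_summand[OF \<nu>, unfolded One_nat_def] simp del: upt_Suc split: if_splits)
  also have "\<dots> \<longleftrightarrow> ((\<lambda>(i, m, ns). list_term i m ns) has_sum theta C / qpoch_inf Q Q)
      (UNIV \<times> UNIV \<times> {ns. length ns = Suc k})"
  proof (rule has_sum_reindex_bij_witness[of _ "\<lambda>(i, m, ns). (i, m, \<lambda>j\<in>{1..\<nu>}. ns ! (j - 1))"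
        "\<lambda>(i, m, n). (i, m, l n)"])
    have *: "(\<lambda>j\<in>{1..\<nu>}. l n ! (j - 1)) = n" if "n \<in> E" for n
    proof
      fix j
      show "(\<lambda>j\<in>{1..\<nu>}. l n ! (j - 1)) j = n j"
      proof (cases "j \<in> {1..\<nu>}")
        case True
        hence "l n ! (j - 1) = n j"
          unfolding l_def by (subst nth_map) (auto simp del: upt_Suc)
        thus ?thesis using True by simp
      next
        case False
        thus ?thesis using that by (auto simp: E_def PiE_def extensional_def)
      qed
    qed
    show "(case (case x of (i, m, n) \<Rightarrow> (i, m, l n)) of (i, m, ns) \<Rightarrow> (i, m, \<lambda>j\<in>{1..\<nu>}. ns ! (j - 1))) = x"
      if "x \<in> UNIV \<times> UNIV \<times> E" for x
      using that * by auto
    show "(case (case x of (i, m, ns) \<Rightarrow> (i, m, \<lambda>j\<in>{1..\<nu>}. ns ! (j - 1))) of (i, m, n) \<Rightarrow> (i, m, l n)) = x"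
      if "x \<in> UNIV \<times> UNIV \<times> {ns. length ns = Suc k}" for x
      using that by (auto simp: l_def k intro!: nth_equalityI simp del: upt_Suc)
  qed (auto simp: E_def l_def k)
  moreover have "2 * C = (k + 3) * (k + 2)"
    using C by (simp add: k algebra_simps)
  ultimately show ?thesis
    using list_term_has_sum[of C k] by blast
qed

end

theorem theorem6p6:
  fixes \<nu> C :: nat and q :: complex
  assumes "\<nu> > 0"
    and "C = (\<nu> + 2) choose 2"
    and "norm q < 1"
  shows "((\<lambda>(i, m, n). summand \<nu> q i m n) has_sum
           (qpoch_infs [q ^ (6 * C), - (q ^ (3 * C + 1)), - (q ^ (3 * C - 1))] (q ^ (6 * C))
            / qpoch_inf (q ^ 3) (q ^ 3))) (index_set \<nu>)"
proof -
  define s where "s = csqrt q"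
  have q: "q = s ^ 2"
    by (simp add: s_def)
  have "norm s < 1"
    using assms(3) by (simp add: q norm_power power_less_one_iff)
  then interpret half_nome s
    by unfold_locales
  have C: "2 * C = (\<nu> + 2) * (\<nu> + 1)"
    using assms(2) by (simp add: choose_two)
  have e: "q ^ (6 * C) = s ^ (12 * C)" "q ^ (3 * C + 1) = s ^ (6 * C + 2)"
    "q ^ (3 * C - 1) = s ^ (6 * C - 2)" "q ^ 3 = Q"
    unfolding q power_mult[symmetric]
    by (rule arg_cong[where f = "\<lambda>n. s ^ n"], simp add: diff_mult_distrib2)+
  have th: "qpoch_infs [q ^ (6 * C), - (q ^ (3 * C + 1)), - (q ^ (3 * C - 1))] (q ^ (6 * C)) = theta C"
    unfolding e by (simp add: qpoch_infs_def theta_def)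
  show ?thesis
    unfolding th e(4) using summand_has_sum[OF assms(1) C] by (simp only: q[symmetric])
qed
end
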